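(* Let $\Bbbk$ be a field of characteristic zero and let $A$ be a noetherian Poisson domain over $\Bbbk$ with finite Krull dimension and $\mathbb D(1)=A$. Then $A$ is strongly Poisson skew cancellative.
   Context: A Poisson algebra is a commutative $\Bbbk$-algebra with a $\Bbbk$-bilinear bracket that is a Lie bracket and a biderivation; a Poisson domain is a Poisson algebra that is a domain. Divisor subalgebra. For a nonempty $F\subseteq A$ with $F\neq\{0\}$, let $\mathrm{Sw}(F)$ be the set of all $g\in A$ such that $f=gb$ for some $0\neq f\in F$ and some $b\in A$. Put $D_0(F)=F$ and, for $n\ge1$, let $D_n(F)$ be the Poisson $\Bbbk$-subalgebra of $A$ generated by $\mathrm{Sw}(D_{n-1}(F))$. Then $\mathbb D(F)=\bigcup_{n\ge0}D_n(F)$, and $\mathbb D(1)=\mathbb D(\{1\})$. Poisson-Ore extensions. A Poisson derivation of $A$ is a $\Bbbk$-linear derivation $\alpha$ with $\alpha(\{a,b\})=\{\alpha(a),b\}+\{a,\alpha(b)\}$. A Poisson $\alpha$-derivation is a $\Bbbk$-linear derivation $\delta$ with $\delta(\{a,b\})=\{\delta(a),b\}+\{a,\delta(b)\}+\delta(a)\alpha(b)-\alpha(a)\delta(b)$. The Poisson-Ore extension $A[t;\alpha,\delta]_P$ is $A[t]$ with the Poisson bracket extending that of $A$ and satisfying $\{a,t\}=\alpha(a)t+\delta(a)$ for $a\in A$. Iterated extensions $A[t_1;\alpha_1,\delta_1]_P\cdots[t_n;\alpha_n,\delta_n]_P$ are formed by repeating this construction. $A$ is strongly Poisson skew cancellative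 if for every $n\ge1$ and every Poisson algebra $A'$, any Poisson isomorphism $A[t_1;\alpha_1,\delta_1]_P\cdots[t_n;\alpha_n,\delta_n]_P\cong A'[t_1';\alpha_1',\delta_1']_P\cdots[t_n';\alpha_n',\delta_n']_P$ implies a Poisson isomorphism $A\cong A'$. *)

theory Defs
  imports
    "HOL-Algebra.UnivPoly"
    "HOL-Algebra.QuotRing"
    "HOL-Algebra.Subrings"
    "HOL-Algebra.Ring_Divisibility"
    "HOL-Library.Extended_Nat"
begin

section \<open>Poisson algebras\<close>

record ('k, 'a) poisson = "('k, 'a) module" +
  pbracket :: "'a \<Rightarrow> 'a \<Rightarrow> 'a" ("\<lbrace>_,/ _\<rbrace>\<index>")

text \<open>
  Linearity and the Leibniz rule in the second argument follow from those in the first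
  and from antisymmetry, but the biderivation property is stated in full.
\<close>

locale poisson_algebra = algebra K A + ground: field K
  for K :: "('k, 'm) ring_scheme" (structure)
    and A :: "('k, 'a, 'n) poisson_scheme" (structure) +
  assumes bracket_closed:
      "\<lbrakk>x \<in> carrier A; y \<in> carrier A\<rbrakk> \<Longrightarrow> \<lbrace>x, y\<rbrace>\<^bsub>A\<^esub> \<in> carrier A"
    and bracket_add_left:
      "\<lbrakk>x \<in> carrier A; y \<in> carrier A; z \<in> carrier A\<rbrakk>
        \<Longrightarrow> \<lbrace>x \<oplus>\<^bsub>A\<^esub> y, z\<rbrace>\<^bsub>A\<^esub> = \<lbrace>x, z\<rbrace>\<^bsub>A\<^esub> \<oplus>\<^bsub>A\<^esub> \<lbrace>y, z\<rbrace>\<^bsub>A\<^esub>"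
    and bracket_add_right:
      "\<lbrakk>x \<in> carrier A; y \<in> carrier A; z \<in> carrier A\<rbrakk>
        \<Longrightarrow> \<lbrace>x, y \<oplus>\<^bsub>A\<^esub> z\<rbrace>\<^bsub>A\<^esub> = \<lbrace>x, y\<rbrace>\<^bsub>A\<^esub> \<oplus>\<^bsub>A\<^esub> \<lbrace>x, z\<rbrace>\<^bsub>A\<^esub>"
    and bracket_smult_left:
      "\<lbrakk>c \<in> carrier K; x \<in> carrier A; y \<in> carrier A\<rbrakk>
        \<Longrightarrow> \<lbrace>c \<odot>\<^bsub>A\<^esub> x, y\<rbrace>\<^bsub>A\<^esub> = c \<odot>\<^bsub>A\<^esub> \<lbrace>x, y\<rbrace>\<^bsub>A\<^esub>"
    and bracket_smult_right:
      "\<lbrakk>c \<in> carrier K; x \<in> carrier A; y \<in> carrier A\<rbrakk>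
        \<Longrightarrow> \<lbrace>x, c \<odot>\<^bsub>A\<^esub> y\<rbrace>\<^bsub>A\<^esub> = c \<odot>\<^bsub>A\<^esub> \<lbrace>x, y\<rbrace>\<^bsub>A\<^esub>"
    and bracket_self: "x \<in> carrier A \<Longrightarrow> \<lbrace>x, x\<rbrace>\<^bsub>A\<^esub> = \<zero>\<^bsub>A\<^esub>"
    and jacobi:
      "\<lbrakk>x \<in> carrier A; y \<in> carrier A; z \<in> carrier A\<rbrakk>
        \<Longrightarrow> \<lbrace>x, \<lbrace>y, z\<rbrace>\<^bsub>A\<^esub>\<rbrace>\<^bsub>A\<^esub> \<oplus>\<^bsub>A\<^esub> \<lbrace>y, \<lbrace>z, x\<rbrace>\<^bsub>A\<^esub>\<rbrace>\<^bsub>A\<^esub> \<oplus>\<^bsub>A\<^esub> \<lbrace>z, \<lbrace>x, y\<rbrace>\<^bsub>A\<^esub>\<rbrace>\<^bsub>A\<^esub> = \<zero>\<^bsub>A\<^esub>"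
    and leibniz_left:
      "\<lbrakk>x \<in> carrier A; y \<in> carrier A; z \<in> carrier A\<rbrakk>
        \<Longrightarrow> \<lbrace>x \<otimes>\<^bsub>A\<^esub> y, z\<rbrace>\<^bsub>A\<^esub> = \<lbrace>x, z\<rbrace>\<^bsub>A\<^esub> \<otimes>\<^bsub>A\<^esub> y \<oplus>\<^bsub>A\<^esub> x \<otimes>\<^bsub>A\<^esub> \<lbrace>y, z\<rbrace>\<^bsub>A\<^esub>"
    and leibniz_right:
      "\<lbrakk>x \<in> carrier A; y \<in> carrier A; z \<in> carrier A\<rbrakk>
        \<Longrightarrow> \<lbrace>x, y \<otimes>\<^bsub>A\<^esub> z\<rbrace>\<^bsub>A\<^esub> = \<lbrace>x, y\<rbrace>\<^bsub>A\<^esub> \<otimes>\<^bsub>A\<^esub> z \<oplus>\<^bsub>A\<^esub> y \<otimes>\<^bsub>A\<^esub> \<lbrace>x, z\<rbrace>\<^bsub>A\<^esub>"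

definition poisson_subalgebra ::
    "('k, 'm) ring_scheme \<Rightarrow> ('k, 'a, 'n) poisson_scheme \<Rightarrow> 'a set \<Rightarrow> bool" where
  "poisson_subalgebra K A S \<longleftrightarrow> subring S A
     \<and> (\<forall>c\<in>carrier K. \<forall>x\<in>S. c \<odot>\<^bsub>A\<^esub> x \<in> S)
     \<and> (\<forall>x\<in>S. \<forall>y\<in>S. \<lbrace>x, y\<rbrace>\<^bsub>A\<^esub> \<in> S)"

definition poisson_generate ::
    "('k, 'm) ring_scheme \<Rightarrow> ('k, 'a, 'n) poisson_scheme \<Rightarrow> 'a set \<Rightarrow> 'a set" where
  "poisson_generate K A X = \<Inter>{S. poisson_subalgebra K A S \<and> X \<subseteq> S}"

definition poisson_iso ::
    "('k, 'm) ring_scheme \<Rightarrow> ('k, 'a, 'n) poisson_scheme \<Rightarrow> ('k, 'b, 'p) poisson_scheme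
      \<Rightarrow> ('a \<Rightarrow> 'b) set" where
  "poisson_iso K A B = {h \<in> ring_iso A B.
     (\<forall>c\<in>carrier K. \<forall>x\<in>carrier A. h (c \<odot>\<^bsub>A\<^esub> x) = c \<odot>\<^bsub>B\<^esub> h x)
     \<and> (\<forall>x\<in>carrier A. \<forall>y\<in>carrier A. h \<lbrace>x, y\<rbrace>\<^bsub>A\<^esub> = \<lbrace>h x, h y\<rbrace>\<^bsub>B\<^esub>)}"

definition poisson_isomorphic ::
    "('k, 'm) ring_scheme \<Rightarrow> ('k, 'a, 'n) poisson_scheme \<Rightarrow> ('k, 'b, 'p) poisson_scheme \<Rightarrow> bool" where
  "poisson_isomorphic K A B \<longleftrightarrow> poisson_iso K A B \<noteq> {}"


section \<open>Characteristic zero and Krull dimension\<close>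

definition char_zero :: "('k, 'm) ring_scheme \<Rightarrow> bool" where
  "char_zero K \<longleftrightarrow> (\<forall>n::nat. n > 0 \<longrightarrow> [n] \<cdot>\<^bsub>K\<^esub> \<one>\<^bsub>K\<^esub> \<noteq> \<zero>\<^bsub>K\<^esub>)"

definition prime_chain :: "('a, 'm) ring_scheme \<Rightarrow> nat \<Rightarrow> (nat \<Rightarrow> 'a set) \<Rightarrow> bool" where
  "prime_chain R n P \<longleftrightarrow> (\<forall>i\<le>n. primeideal (P i) R) \<and> (\<forall>i<n. P i \<subset> P (Suc i))"

definition krull_dim :: "('a, 'm) ring_scheme \<Rightarrow> enat" where
  "krull_dim R = Sup {enat n | n. \<exists>P. prime_chain R n P}"


section \<open>The divisor subalgebra\<close>

definition Sw :: "('a, 'm) ring_scheme \<Rightarrow> 'a set \<Rightarrow> 'a set" where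
  "Sw A F = {g \<in> carrier A. \<exists>f\<in>F. f \<noteq> \<zero>\<^bsub>A\<^esub> \<and> (\<exists>b\<in>carrier A. f = g \<otimes>\<^bsub>A\<^esub> b)}"

primrec divisor_step ::
    "('k, 'm) ring_scheme \<Rightarrow> ('k, 'a, 'n) poisson_scheme \<Rightarrow> 'a set \<Rightarrow> nat \<Rightarrow> 'a set" where
  "divisor_step K A F 0 = F"
| "divisor_step K A F (Suc n) = poisson_generate K A (Sw A (divisor_step K A F n))"

definition divisor_subalgebra ::
    "('k, 'm) ring_scheme \<Rightarrow> ('k, 'a, 'n) poisson_scheme \<Rightarrow> 'a set \<Rightarrow> 'a set" where
  "divisor_subalgebra K A F = (\<Union>n. divisor_step K A F n)"


section \<open>Poisson-Ore extensions\<close>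

definition linear_derivation ::
    "('k, 'm) ring_scheme \<Rightarrow> ('k, 'a, 'n) poisson_scheme \<Rightarrow> ('a \<Rightarrow> 'a) \<Rightarrow> bool" where
  "linear_derivation K A d \<longleftrightarrow> d \<in> carrier A \<rightarrow> carrier A
     \<and> (\<forall>x\<in>carrier A. \<forall>y\<in>carrier A. d (x \<oplus>\<^bsub>A\<^esub> y) = d x \<oplus>\<^bsub>A\<^esub> d y)
     \<and> (\<forall>c\<in>carrier K. \<forall>x\<in>carrier A. d (c \<odot>\<^bsub>A\<^esub> x) = c \<odot>\<^bsub>A\<^esub> d x)
     \<and> (\<forall>x\<in>carrier A. \<forall>y\<in>carrier A. d (x \<otimes>\<^bsub>A\<^esub> y) = d x \<otimes>\<^bsub>A\<^esub> y \<oplus>\<^bsub>A\<^esub> x \<otimes>\<^bsub>A\<^esub> d y)"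

definition poisson_derivation ::
    "('k, 'm) ring_scheme \<Rightarrow> ('k, 'a, 'n) poisson_scheme \<Rightarrow> ('a \<Rightarrow> 'a) \<Rightarrow> bool" where
  "poisson_derivation K A \<alpha> \<longleftrightarrow> linear_derivation K A \<alpha>
     \<and> (\<forall>a\<in>carrier A. \<forall>b\<in>carrier A.
          \<alpha> \<lbrace>a, b\<rbrace>\<^bsub>A\<^esub> = \<lbrace>\<alpha> a, b\<rbrace>\<^bsub>A\<^esub> \<oplus>\<^bsub>A\<^esub> \<lbrace>a, \<alpha> b\<rbrace>\<^bsub>A\<^esub>)"

definition poisson_skew_derivation ::
    "('k, 'm) ring_scheme \<Rightarrow> ('k, 'a, 'n) poisson_scheme \<Rightarrow> ('a \<Rightarrow> 'a) \<Rightarrow> ('a \<Rightarrow> 'a) \<Rightarrow> bool" where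
  "poisson_skew_derivation K A \<alpha> \<delta> \<longleftrightarrow> linear_derivation K A \<delta>
     \<and> (\<forall>a\<in>carrier A. \<forall>b\<in>carrier A.
          \<delta> \<lbrace>a, b\<rbrace>\<^bsub>A\<^esub> = (\<lbrace>\<delta> a, b\<rbrace>\<^bsub>A\<^esub> \<oplus>\<^bsub>A\<^esub> \<lbrace>a, \<delta> b\<rbrace>\<^bsub>A\<^esub> \<oplus>\<^bsub>A\<^esub> \<delta> a \<otimes>\<^bsub>A\<^esub> \<alpha> b) \<ominus>\<^bsub>A\<^esub> \<alpha> a \<otimes>\<^bsub>A\<^esub> \<delta> b)"

text \<open>
  The polynomial algebra over the ground field, carrying a given bracket. The scalar
  multiplication of \<^const>\<open>UP\<close> is by elements of the coefficient ring; here it is replaced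
  by the coefficientwise action of the ground field.
\<close>

definition poly_poisson ::
    "('k, 'a, 'n) poisson_scheme \<Rightarrow> ((nat \<Rightarrow> 'a) \<Rightarrow> (nat \<Rightarrow> 'a) \<Rightarrow> (nat \<Rightarrow> 'a))
      \<Rightarrow> ('k, nat \<Rightarrow> 'a) poisson" where
  "poly_poisson A br =
     \<lparr>carrier = carrier (UP A), monoid.mult = monoid.mult (UP A), one = one (UP A),
      zero = zero (UP A), add = add (UP A), smult = (\<lambda>c p i. c \<odot>\<^bsub>A\<^esub> p i), pbracket = br\<rparr>"

abbreviation const_poly :: "('a, 'm) ring_scheme \<Rightarrow> 'a \<Rightarrow> (nat \<Rightarrow> 'a)" where
  "const_poly A a \<equiv> monom (UP A) a 0"

abbreviation poly_var :: "('a, 'm) ring_scheme \<Rightarrow> (nat \<Rightarrow> 'a)" where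
  "poly_var A \<equiv> monom (UP A) \<one>\<^bsub>A\<^esub> 1"

text \<open>
  \<open>poisson_ore_ext K A \<alpha> \<delta> B\<close>: \<open>B\<close> is the Poisson-Ore extension of \<open>A\<close> by \<open>\<alpha>\<close> and \<open>\<delta>\<close>.
  The defining conditions determine the bracket on the carrier of the polynomial algebra,
  so \<open>B\<close> is unique up to irrelevant values of the bracket outside the carrier.
\<close>

definition poisson_ore_ext ::
    "('k, 'm) ring_scheme \<Rightarrow> ('k, 'a, 'n) poisson_scheme \<Rightarrow> ('a \<Rightarrow> 'a) \<Rightarrow> ('a \<Rightarrow> 'a)
      \<Rightarrow> ('k, nat \<Rightarrow> 'a) poisson \<Rightarrow> bool" where
  "poisson_ore_ext K A \<alpha> \<delta> B \<longleftrightarrow>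
     poisson_derivation K A \<alpha> \<and> poisson_skew_derivation K A \<alpha> \<delta>
     \<and> poisson_algebra K B \<and> (\<exists>br. B = poly_poisson A br)
     \<and> (\<forall>a\<in>carrier A. \<forall>b\<in>carrier A.
          \<lbrace>const_poly A a, const_poly A b\<rbrace>\<^bsub>B\<^esub> = const_poly A \<lbrace>a, b\<rbrace>\<^bsub>A\<^esub>)
     \<and> (\<forall>a\<in>carrier A.
          \<lbrace>const_poly A a, poly_var A\<rbrace>\<^bsub>B\<^esub>
            = const_poly A (\<alpha> a) \<otimes>\<^bsub>B\<^esub> poly_var A \<oplus>\<^bsub>B\<^esub> const_poly A (\<delta> a))"

text \<open>
  Each extension step changes the type of elements from \<open>'a\<close> to \<open>nat \<Rightarrow> 'a\<close>. To iterate
  it a variable number of times, all stages are placed in one recursive type: \<open>Base\<close>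
  injects the elements of the base algebra, and \<open>Coeffs\<close> turns a sequence of elements of
  one stage, viewed as a polynomial, into an element of the next stage.
\<close>

datatype 'a iter_poly = Base 'a | Coeffs "nat \<Rightarrow> 'a iter_poly"

text \<open>Transport of structure along a map that is injective on the carrier.\<close>

definition image_poisson ::
    "('a \<Rightarrow> 'b) \<Rightarrow> ('k, 'a, 'n) poisson_scheme \<Rightarrow> ('k, 'b) poisson" where
  "image_poisson f A = (let g = inv_into (carrier A) f in
     \<lparr>carrier = f ` carrier A,
      monoid.mult = (\<lambda>x y. f (g x \<otimes>\<^bsub>A\<^esub> g y)), one = f \<one>\<^bsub>A\<^esub>,
      zero = f \<zero>\<^bsub>A\<^esub>, add = (\<lambda>x y. f (g x \<oplus>\<^bsub>A\<^esub> g y)),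
      smult = (\<lambda>c x. f (c \<odot>\<^bsub>A\<^esub> g x)),
      pbracket = (\<lambda>x y. f \<lbrace>g x, g y\<rbrace>\<^bsub>A\<^esub>)\<rparr>)"

text \<open>
  \<open>iterated_poisson_ore K A n B\<close>: \<open>B\<close> is an \<open>n\<close>-step iterated Poisson-Ore extension of \<open>A\<close>,
  where at each step \<open>\<alpha>\<close> and \<open>\<delta>\<close> act on the previously built algebra.
\<close>

primrec iterated_poisson_ore ::
    "('k, 'm) ring_scheme \<Rightarrow> ('k, 'a, 'n) poisson_scheme \<Rightarrow> nat
      \<Rightarrow> ('k, 'a iter_poly) poisson \<Rightarrow> bool" where
  "iterated_poisson_ore K A 0 B \<longleftrightarrow> B = image_poisson Base A"
| "iterated_poisson_ore K A (Suc n) B \<longleftrightarrow>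
     (\<exists>C \<alpha> \<delta> D. iterated_poisson_ore K A n C \<and> poisson_ore_ext K C \<alpha> \<delta> D
        \<and> B = image_poisson Coeffs D)"


section \<open>Strong Poisson skew cancellativity\<close>

text \<open>
  A HOL definition cannot quantify over types, so the type \<open>'b\<close> of the elements of the
  competing algebra \<open>A'\<close> is an explicit type argument. A theorem that leaves \<open>'b\<close> free
  covers Poisson algebras \<open>A'\<close> of every type.
\<close>

definition strongly_poisson_skew_cancellative ::
    "'b itself \<Rightarrow> ('k, 'm) ring_scheme \<Rightarrow> ('k, 'a, 'n) poisson_scheme \<Rightarrow> bool" where
  "strongly_poisson_skew_cancellative (_ :: 'b itself) K A \<longleftrightarrow>
     (\<forall>n (A' :: ('k, 'b) poisson) B B'.
        n \<ge> 1 \<longrightarrow> poisson_algebra K A'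
        \<longrightarrow> iterated_poisson_ore K A n B \<longrightarrow> iterated_poisson_ore K A' n B'
        \<longrightarrow> poisson_isomorphic K B B' \<longrightarrow> poisson_isomorphic K A A')"

end

theory Submission
  imports Defs
begin

text \<open>
  Let \<open>B\<close> and \<open>B'\<close> be \<open>n\<close>-step iterated Poisson-Ore extensions of \<open>A\<close> and \<open>A'\<close>, and let
  \<open>h\<close> be a Poisson isomorphism from \<open>B\<close> to \<open>B'\<close>. As commutative rings, both are polynomial
  rings in \<open>n\<close> variables. Write \<open>T\<close> for the image of \<open>A\<close> in \<open>B'\<close> under \<open>h\<close>, and \<open>U\<close> for the
  copy of \<open>A'\<close> in \<open>B'\<close>. The goal is to show that \<open>T\<close> and \<open>U\<close> are equal: then \<open>h\<close> restricts
  to a Poisson isomorphism from \<open>A\<close> to \<open>A'\<close>.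

  The ring \<open>B'\<close> is a domain, because \<open>B\<close> is a polynomial ring over a domain. Comparing degrees
  shows that the coefficient ring of a polynomial ring over a domain is factor-closed: it contains
  every factor of each of its nonzero elements. Hence \<open>T\<close> and \<open>U\<close> are factor-closed Poisson
  subalgebras of \<open>B'\<close>. The preimage of \<open>U\<close> in \<open>A\<close> is then a factor-closed Poisson
  subalgebra of \<open>A\<close>, and such a subalgebra contains the divisor subalgebra of 1, which is \<open>A\<close>
  (\<open>divisor_subalgebra_subset_factor_closed\<close>). This proves \<open>T \<subseteq> U\<close>.

  For equality, suppose that \<open>a\<close> lies in \<open>U\<close> but not in \<open>T\<close>. A factor-closed subring of a
  domain is algebraically closed in it, so \<open>a\<close> is transcendental over \<open>T\<close>
  (\<open>algebraically_independent_of_not_mem_factor_closed\<close>). Then \<open>a\<close> and the \<open>n\<close> variables of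
  \<open>B'\<close> over \<open>U\<close> are \<open>n + 1\<close> algebraically independent elements over \<open>T\<close> in a ring that is
  generated over \<open>T\<close> by \<open>n\<close> elements. Counting monomials shows that this is impossible
  (\<open>length_le_of_algebraically_independent\<close>).
\<close>

section \<open>Linear independence over a subring\<close>

definition independent_family ::
    "('a, 'm) ring_scheme \<Rightarrow> 'a set \<Rightarrow> 'i set \<Rightarrow> ('i \<Rightarrow> 'a) \<Rightarrow> bool" where
  "independent_family R T I v \<longleftrightarrow>
     (\<forall>c\<in>I \<rightarrow> T. (\<Oplus>\<^bsub>R\<^esub>i\<in>I. c i \<otimes>\<^bsub>R\<^esub> v i) = \<zero>\<^bsub>R\<^esub> \<longrightarrow> (\<forall>i\<in>I. c i = \<zero>\<^bsub>R\<^esub>))"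

lemma independent_familyD:
  assumes "independent_family R T I v" "c \<in> I \<rightarrow> T"
    and "(\<Oplus>\<^bsub>R\<^esub>i\<in>I. c i \<otimes>\<^bsub>R\<^esub> v i) = \<zero>\<^bsub>R\<^esub>" "i \<in> I"
  shows "c i = \<zero>\<^bsub>R\<^esub>"
  using assms unfolding independent_family_def by blast

text \<open>
  The linear span over a subring is given inductively rather than by finite sums, so that
  closure properties need only rule induction. The rule for zero makes the span of the
  empty set the zero module.
\<close>

inductive_set lin_span :: "('a, 'm) ring_scheme \<Rightarrow> 'a set \<Rightarrow> 'a set \<Rightarrow> 'a set"
  for R (structure) and T G where
  zero: "\<zero> \<in> lin_span R T G"
| gen: "\<lbrakk>t \<in> T; g \<in> G\<rbrakk> \<Longrightarrow> t \<otimes> g \<in> lin_span R T G"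
| add: "\<lbrakk>x \<in> lin_span R T G; y \<in> lin_span R T G\<rbrakk> \<Longrightarrow> x \<oplus> y \<in> lin_span R T G"

lemma lin_span_mono: "G \<subseteq> H \<Longrightarrow> lin_span R T G \<subseteq> lin_span R T H"
proof
  fix x assume "x \<in> lin_span R T G" "G \<subseteq> H"
  then show "x \<in> lin_span R T H" by induction (auto intro: lin_span.intros)
qed

context cring
begin

lemma lin_span_closed:
  assumes "T \<subseteq> carrier R" "G \<subseteq> carrier R" "x \<in> lin_span R T G"
  shows "x \<in> carrier R"
  using assms(3) by induction (use assms(1,2) in auto)

lemma lin_span_smult:
  assumes T: "subring T R" and G: "G \<subseteq> carrier R" and t: "t \<in> T" and x: "x \<in> lin_span R T G"
  shows "t \<otimes> x \<in> lin_span R T G"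
  using x
proof induction
  case zero
  have "t \<in> carrier R" using subringE(1)[OF T] t by auto
  then show ?case by (simp add: lin_span.zero)
next
  case (gen s g)
  then have "t \<in> carrier R" "s \<in> carrier R" "g \<in> carrier R"
    using subringE(1)[OF T] t G by auto
  then have "t \<otimes> (s \<otimes> g) = (t \<otimes> s) \<otimes> g" by (simp add: m_assoc)
  moreover have "(t \<otimes> s) \<otimes> g \<in> lin_span R T G"
    using gen by (intro lin_span.gen subringE(6)[OF T t])
  ultimately show ?case by simp
next
  case (add x y)
  moreover have "t \<in> carrier R" "x \<in> carrier R" "y \<in> carrier R"
    using add lin_span_closed[OF subringE(1)[OF T] G] subringE(1)[OF T] t by auto
  ultimately show ?case
    by (simp add: r_distr lin_span.add)
qed

lemma lin_span_minus:
  assumes T: "subring T R" and G: "G \<subseteq> carrier R"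
    and "x \<in> lin_span R T G" "y \<in> lin_span R T G"
  shows "x \<ominus> y \<in> lin_span R T G"
proof -
  have c: "x \<in> carrier R" "y \<in> carrier R"
    using assms lin_span_closed[OF subringE(1)[OF T] G] by auto
  have "x \<ominus> y = x \<oplus> (\<ominus> \<one>) \<otimes> y"
    using c by (simp add: a_minus_def l_minus)
  moreover have "(\<ominus> \<one>) \<otimes> y \<in> lin_span R T G"
    by (rule lin_span_smult[OF T G subringE(5)[OF T subringE(3)[OF T]] assms(4)])
  ultimately show ?thesis
    using lin_span.add[OF assms(3)] by simp
qed

lemma lin_span_insertE:
  assumes T: "subring T R" and G: "insert g G \<subseteq> carrier R"
    and "x \<in> lin_span R T (insert g G)"
  obtains t y where "t \<in> T" "y \<in> lin_span R T G" "x = t \<otimes> g \<oplus> y"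
proof -
  have Tc: "T \<subseteq> carrier R" using subringE(1)[OF T] .
  have "\<exists>t\<in>T. \<exists>y\<in>lin_span R T G. x = t \<otimes> g \<oplus> y"
    using assms(3)
  proof induction
    case zero
    show ?case
      by (rule bexI[of _ \<zero>], rule bexI[of _ \<zero>])
         (use G subringE(2)[OF T] in \<open>auto intro: lin_span.zero\<close>)
  next
    case (gen t h)
    show ?case
    proof (cases "h = g")
      case True
      show ?thesis
        by (rule bexI[of _ t], rule bexI[of _ \<zero>])
           (use True G gen Tc in \<open>auto intro: lin_span.zero\<close>)
    next
      case False
      then have "h \<in> G" using gen by simp
      then have "h \<in> carrier R" "t \<in> carrier R" "g \<in> carrier R"
        using G gen(1) Tc by blast+
      then have "t \<otimes> h = \<zero> \<otimes> g \<oplus> t \<otimes> h" by simp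
      then show ?thesis
        using subringE(2)[OF T] lin_span.gen[OF gen(1) \<open>h \<in> G\<close>, of R] by blast
    qed
  next
    case (add x x')
    then obtain t y t' y' where *: "t \<in> T" "y \<in> lin_span R T G" "x = t \<otimes> g \<oplus> y"
      "t' \<in> T" "y' \<in> lin_span R T G" "x' = t' \<otimes> g \<oplus> y'" by blast
    then have "y \<in> carrier R" "y' \<in> carrier R"
      using lin_span_closed[OF Tc] G by auto
    then have "x \<oplus> x' = (t \<oplus> t') \<otimes> g \<oplus> (y \<oplus> y')"
      using * Tc G by (auto simp: l_distr subset_iff a_ac)
    then show ?case
      using subringE(7)[OF T *(1,4)] lin_span.add[OF *(2,5)] by (meson bexI)
  qed
  then show ?thesis using that by blast
qed

lemma finsum_mem:
  assumes "\<zero> \<in> U" "\<And>x y. \<lbrakk>x \<in> U; y \<in> U\<rbrakk> \<Longrightarrow> x \<oplus> y \<in> U" "U \<subseteq> carrier R"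
    and "f \<in> I \<rightarrow> U"
  shows "finsum R f I \<in> U"
  using assms(4)
proof (induction I rule: infinite_finite_induct)
  case (insert i I)
  then have "f \<in> I \<rightarrow> carrier R" "f i \<in> carrier R" using assms(3) by auto
  then show ?case using insert assms(2) by (auto simp: Pi_def)
qed (use assms(1) in auto)

end

text \<open>
  Over a domain, a homogeneous linear system with more unknowns than equations has a
  nontrivial solution. The induction removes one generator at a time by Gaussian
  elimination; as the coefficients cannot be divided, the pivot row is cross-multiplied.
\<close>

lemma (in domain) card_le_of_independent_lin_span:
  fixes I :: "'i set"
  assumes T: "subring T R"
    and "finite G" "G \<subseteq> carrier R" "finite I" "v \<in> I \<rightarrow> lin_span R T G"
    and "independent_family R T I v"
  shows "card I \<le> card G"
proof -
  have Tc: "T \<subseteq> carrier R" using subringE(1)[OF T] .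
  have "\<exists>c\<in>I \<rightarrow> T. (\<Oplus>i\<in>I. c i \<otimes> v i) = \<zero> \<and> (\<exists>i\<in>I. c i \<noteq> \<zero>)"
    if "finite G" "G \<subseteq> carrier R" "finite I" "card G < card I" "v \<in> I \<rightarrow> lin_span R T G"
    for G and I :: "'i set" and v
    using that
  proof (induction G arbitrary: I v)
    case empty
    have "x = \<zero>" if "x \<in> lin_span R T {}" for x
      using that by induction auto
    then have "\<And>i. i \<in> I \<Longrightarrow> v i = \<zero>" using empty by auto
    moreover have "I \<noteq> {}" using empty by auto
    moreover have "\<one> \<in> T" using subringE(3)[OF T] .
    ultimately show ?case
      by (intro bexI[of _ "\<lambda>_. \<one>"]) (auto cong: finsum_cong)
  next
    case (insert g G)
    have g: "g \<in> carrier R" and G: "G \<subseteq> carrier R" using insert by auto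
    have "\<forall>i\<in>I. \<exists>r y. r \<in> T \<and> y \<in> lin_span R T G \<and> v i = r \<otimes> g \<oplus> y"
      using insert.prems(4) lin_span_insertE[OF T insert.prems(1)] by blast
    then obtain r y where ry: "\<And>i. i \<in> I \<Longrightarrow> r i \<in> T" "\<And>i. i \<in> I \<Longrightarrow> y i \<in> lin_span R T G"
      "\<And>i. i \<in> I \<Longrightarrow> v i = r i \<otimes> g \<oplus> y i" by metis
    have rc: "\<And>i. i \<in> I \<Longrightarrow> r i \<in> carrier R" and yc: "\<And>i. i \<in> I \<Longrightarrow> y i \<in> carrier R"
      using ry Tc lin_span_closed[OF Tc G] by auto
    have vc: "\<And>i. i \<in> I \<Longrightarrow> v i \<in> carrier R" using ry rc yc g by auto
    show ?case
    proof (cases "\<forall>i\<in>I. r i = \<zero>")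
      case True
      then have "v \<in> I \<rightarrow> lin_span R T G" using ry g yc by auto
      then show ?thesis using insert.IH[of I v] insert G by auto
    next
      case False
      then obtain k where k: "k \<in> I" "r k \<noteq> \<zero>" by blast
      define J where "J = I - {k}"
      \<comment> \<open>Cross-multiplication with the pivot \<open>k\<close> cancels the coefficient of \<open>g\<close>.\<close>
      define w where "w = (\<lambda>i. r k \<otimes> v i \<ominus> r i \<otimes> v k)"
      have J: "J \<subseteq> I" "finite J" "k \<notin> J" "I = insert k J" using k insert by (auto simp: J_def)
      have "w i \<in> lin_span R T G" if "i \<in> J" for i
      proof -
        have i: "i \<in> I" using that J by auto
        have "w i = r k \<otimes> y i \<ominus> r i \<otimes> y k"
          unfolding w_def ry(3)[OF i] ry(3)[OF k(1)]
          using rc[OF i] yc[OF i] rc[OF k(1)] yc[OF k(1)] g by algebra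
        then show ?thesis
          using i k ry lin_span_minus[OF T G] lin_span_smult[OF T G] by simp
      qed
      moreover have "card G < card J" using insert J by auto
      ultimately have "\<exists>c\<in>J \<rightarrow> T. (\<Oplus>i\<in>J. c i \<otimes> w i) = \<zero> \<and> (\<exists>i\<in>J. c i \<noteq> \<zero>)"
        by (intro insert.IH[OF G J(2)]) auto
      then obtain c where c: "c \<in> J \<rightarrow> T" "(\<Oplus>i\<in>J. c i \<otimes> w i) = \<zero>" "\<exists>i\<in>J. c i \<noteq> \<zero>"
        by blast
      have cc: "\<And>i. i \<in> J \<Longrightarrow> c i \<in> carrier R" using c Tc by auto
      define s where "s = (\<Oplus>i\<in>J. c i \<otimes> r i)"
      \<comment> \<open>Collecting the multiples of \<open>v k\<close> in the relation among the \<open>w i\<close> gives a relation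
        among the \<open>v i\<close>; it is nontrivial because \<open>r k\<close> is not a zero divisor.\<close>
      define d where "d = (\<lambda>i. if i = k then \<ominus> s else c i \<otimes> r k)"
      have "s \<in> T" unfolding s_def
        by (rule finsum_mem) (use subringE[OF T] c ry(1) J in \<open>auto simp: Pi_def subset_iff\<close>)
      then have sc: "s \<in> carrier R" and dT: "d \<in> I \<rightarrow> T"
        using Tc subringE[OF T] c ry(1) k J by (auto simp: d_def Pi_def)
      have "(\<Oplus>i\<in>J. d i \<otimes> v i) = (\<Oplus>i\<in>J. c i \<otimes> w i \<oplus> (c i \<otimes> r i) \<otimes> v k)"
      proof (rule finsum_cong')
        fix i assume i: "i \<in> J"
        then have "i \<in> I" using J by auto
        then show "d i \<otimes> v i = c i \<otimes> w i \<oplus> (c i \<otimes> r i) \<otimes> v k"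
          using i J(3) cc[OF i] rc[of i] rc[OF k(1)] vc[of i] vc[OF k(1)]
          unfolding w_def d_def by (cases "i = k") (simp, algebra)
      qed (use cc rc vc k J in \<open>auto simp: w_def\<close>)
      also have "\<dots> = (\<Oplus>i\<in>J. c i \<otimes> w i) \<oplus> (\<Oplus>i\<in>J. (c i \<otimes> r i) \<otimes> v k)"
        by (rule finsum_addf) (use cc rc vc k J in \<open>auto simp: w_def\<close>)
      also have "\<dots> = s \<otimes> v k"
        unfolding s_def c(2) by (subst finsum_ldistr) (use cc rc vc k J in auto)
      finally have "(\<Oplus>i\<in>J. d i \<otimes> v i) = s \<otimes> v k" .
      moreover have "(\<Oplus>i\<in>I. d i \<otimes> v i) = d k \<otimes> v k \<oplus> (\<Oplus>i\<in>J. d i \<otimes> v i)"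
        unfolding J(4) using J dT Tc vc by (subst finsum_insert) (auto simp: Pi_def subset_iff)
      ultimately have "(\<Oplus>i\<in>I. d i \<otimes> v i) = \<zero>"
        using sc vc[OF k(1)] by (simp add: d_def l_minus l_neg)
      moreover obtain i where "i \<in> J" "c i \<noteq> \<zero>" using c by auto
      then have "d i \<noteq> \<zero>"
        using J cc rc k by (auto simp: d_def integral_iff)
      ultimately show ?thesis using dT \<open>i \<in> J\<close> J by blast
    qed
  qed
  then show ?thesis
    using assms(2-6) unfolding independent_family_def by (meson not_le)
qed

lemma (in abelian_monoid) finsum_Times:
  assumes "finite I" "finite J" "\<And>i j. \<lbrakk>i \<in> I; j \<in> J\<rbrakk> \<Longrightarrow> f (i, j) \<in> carrier G"
  shows "(\<Oplus>p\<in>I \<times> J. f p) = (\<Oplus>j\<in>J. \<Oplus>i\<in>I. f (i, j))"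
proof -
  have "I \<times> J = (\<Union>j\<in>J. (\<lambda>i. (i, j)) ` I)" by auto
  then have "(\<Oplus>p\<in>I \<times> J. f p) = (\<Oplus>j\<in>J. \<Oplus>p\<in>(\<lambda>i. (i, j)) ` I. f p)"
    using assms by (simp only:) (subst add.finprod_UN_disjoint,
      auto simp: pairwise_def disjnt_def)
  also have "\<dots> = (\<Oplus>j\<in>J. \<Oplus>i\<in>I. f (i, j))"
  proof (rule finsum_cong')
    fix j assume "j \<in> J"
    then show "(\<Oplus>p\<in>(\<lambda>i. (i, j)) ` I. f p) = (\<Oplus>i\<in>I. f (i, j))"
      using assms by (subst finsum_reindex) (auto simp: inj_on_def)
  qed (use assms in auto)
  finally show ?thesis .
qed

context cring
begin

text \<open>
  The tower law: the products of a family in \<open>U\<close> independent over \<open>T\<close> with a family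
  independent over \<open>U\<close> are independent over \<open>T\<close>, since a relation can be grouped into one with
  coefficients in \<open>U\<close>.
\<close>

lemma independent_family_Times:
  assumes U: "subring U R" and TU: "T \<subseteq> U" and fin: "finite I" "finite J"
    and w: "w \<in> I \<rightarrow> U" "independent_family R T I w"
    and v: "v \<in> J \<rightarrow> carrier R" "independent_family R U J v"
  shows "independent_family R T (I \<times> J) (\<lambda>(i, j). w i \<otimes> v j)"
  unfolding independent_family_def
proof (intro ballI impI, clarify)
  fix c i j
  assume c: "c \<in> I \<times> J \<rightarrow> T" and ij: "i \<in> I" "j \<in> J"
    and sum: "(\<Oplus>p\<in>I \<times> J. c p \<otimes> (case p of (i, j) \<Rightarrow> w i \<otimes> v j)) = \<zero>"
  have Uc: "U \<subseteq> carrier R" using subringE(1)[OF U] .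
  have cU: "\<And>i j. \<lbrakk>i \<in> I; j \<in> J\<rbrakk> \<Longrightarrow> c (i, j) \<in> U" using c TU by auto
  have wU: "\<And>i. i \<in> I \<Longrightarrow> w i \<in> U" using w by auto
  have cc: "\<And>i j. \<lbrakk>i \<in> I; j \<in> J\<rbrakk> \<Longrightarrow> c (i, j) \<in> carrier R" "\<And>i. i \<in> I \<Longrightarrow> w i \<in> carrier R"
    "\<And>j. j \<in> J \<Longrightarrow> v j \<in> carrier R" using cU wU v Uc by auto
  define d where "d = (\<lambda>j. \<Oplus>i\<in>I. c (i, j) \<otimes> w i)"
  have dU: "d \<in> J \<rightarrow> U"
    unfolding d_def
    by (intro Pi_I finsum_mem) (use subringE[OF U] cU wU in auto)
  have "(\<Oplus>j\<in>J. d j \<otimes> v j) = (\<Oplus>j\<in>J. \<Oplus>i\<in>I. c (i, j) \<otimes> (w i \<otimes> v j))"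
    unfolding d_def using cc fin
    by (intro finsum_cong') (auto simp: finsum_ldistr m_assoc Pi_def intro!: finsum_cong')
  also have "\<dots> = \<zero>"
    using sum cc fin by (subst (asm) finsum_Times) auto
  finally have "d j = \<zero>" by (rule independent_familyD[OF v(2) dU _ ij(2)])
  moreover have "(\<lambda>i. c (i, j)) \<in> I \<rightarrow> T" using c ij by auto
  ultimately show "c (i, j) = \<zero>"
    using independent_familyD[OF w(2), of "\<lambda>i. c (i, j)" i] ij unfolding d_def by simp
qed

lemma independent_family_reindex:
  assumes "inj_on h I" "T \<subseteq> carrier R" "v \<in> h ` I \<rightarrow> carrier R"
    and "independent_family R T I (\<lambda>i. v (h i))"
  shows "independent_family R T (h ` I) v"
  unfolding independent_family_def
proof (intro ballI impI)
  fix c k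
  assume c: "c \<in> h ` I \<rightarrow> T" and k: "k \<in> h ` I" and sum: "(\<Oplus>i\<in>h ` I. c i \<otimes> v i) = \<zero>"
  have s0: "(\<Oplus>i\<in>I. c (h i) \<otimes> v (h i)) = \<zero>"
    using sum assms c by (subst (asm) finsum_reindex) (auto simp: Pi_def subset_iff)
  have "(\<lambda>i. c (h i)) \<in> I \<rightarrow> T" using c by auto
  note independent_familyD[OF assms(4) this s0]
  then show "c k = \<zero>" using k by auto
qed

end

lemma independent_family_hom_image:
  assumes "cring R" "cring S" and h: "h \<in> ring_hom R S" "inj_on h (carrier R)"
    and T: "T \<subseteq> carrier R" and v: "v \<in> I \<rightarrow> carrier R" "independent_family R T I v"
  shows "independent_family S (h ` T) I (\<lambda>i. h (v i))"
  unfolding independent_family_def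
proof (intro ballI impI)
  interpret ring_hom_cring R S h
    using assms by (simp add: ring_hom_cring_def ring_hom_cring_axioms_def)
  fix c k
  assume c: "c \<in> I \<rightarrow> h ` T" and k: "k \<in> I" and sum: "(\<Oplus>\<^bsub>S\<^esub>i\<in>I. c i \<otimes>\<^bsub>S\<^esub> h (v i)) = \<zero>\<^bsub>S\<^esub>"
  define d where "d = (\<lambda>i. inv_into T h (c i))"
  have d: "\<And>i. i \<in> I \<Longrightarrow> d i \<in> T" "\<And>i. i \<in> I \<Longrightarrow> c i = h (d i)"
    using c by (auto simp: d_def f_inv_into_f inv_into_into Pi_def)
  have "h (\<Oplus>\<^bsub>R\<^esub>i\<in>I. d i \<otimes>\<^bsub>R\<^esub> v i) = (\<Oplus>\<^bsub>S\<^esub>i\<in>I. c i \<otimes>\<^bsub>S\<^esub> h (v i))"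
    using d T v by (subst hom_finsum) (auto simp: Pi_def subset_iff intro!: S.finsum_cong')
  then have "h (\<Oplus>\<^bsub>R\<^esub>i\<in>I. d i \<otimes>\<^bsub>R\<^esub> v i) = h \<zero>\<^bsub>R\<^esub>" using sum by simp
  moreover have "(\<Oplus>\<^bsub>R\<^esub>i\<in>I. d i \<otimes>\<^bsub>R\<^esub> v i) \<in> carrier R"
    using d T v by (intro R.finsum_closed) (auto simp: Pi_def subset_iff)
  ultimately have "(\<Oplus>\<^bsub>R\<^esub>i\<in>I. d i \<otimes>\<^bsub>R\<^esub> v i) = \<zero>\<^bsub>R\<^esub>"
    using h(2) by (auto simp: inj_on_def)
  then have "d k = \<zero>\<^bsub>R\<^esub>"
    using v(2) d k unfolding independent_family_def by blast
  then show "c k = \<zero>\<^bsub>S\<^esub>" using d k by simp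
qed

section \<open>Algebraic independence and polynomial rings inside a ring\<close>

primrec monomial :: "('a, 'm) ring_scheme \<Rightarrow> 'a list \<Rightarrow> nat list \<Rightarrow> 'a" where
  "monomial R [] es = \<one>\<^bsub>R\<^esub>"
| "monomial R (u # us) es = u [^]\<^bsub>R\<^esub> hd es \<otimes>\<^bsub>R\<^esub> monomial R us (tl es)"

text \<open>
  The bound \<open>m\<close> applies to each exponent separately and not to the total degree. This makes the
  number of exponent vectors an exact power of \<open>Suc m\<close>.
\<close>

definition exponents :: "nat \<Rightarrow> nat \<Rightarrow> nat list set" where
  "exponents n m = {es. set es \<subseteq> {..m} \<and> length es = n}"

definition monomials :: "('a, 'm) ring_scheme \<Rightarrow> 'a list \<Rightarrow> nat \<Rightarrow> 'a set" where
  "monomials R us m = monomial R us ` exponents (length us) m"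

definition algebraically_independent ::
    "('a, 'm) ring_scheme \<Rightarrow> 'a set \<Rightarrow> 'a list \<Rightarrow> bool" where
  "algebraically_independent R T us \<longleftrightarrow>
     (\<forall>m. independent_family R T (exponents (length us) m) (monomial R us))"

definition polynomial_ring_over ::
    "('a, 'm) ring_scheme \<Rightarrow> 'a set \<Rightarrow> 'a list \<Rightarrow> bool" where
  "polynomial_ring_over R T us \<longleftrightarrow> set us \<subseteq> carrier R \<and> algebraically_independent R T us
     \<and> carrier R \<subseteq> (\<Union>m. lin_span R T (monomials R us m))"

lemma finite_exponents: "finite (exponents n m)"
  and card_exponents: "card (exponents n m) = Suc m ^ n"
  unfolding exponents_def by (simp_all add: finite_lists_length_eq card_lists_length_eq)

lemma exponents_append:
  "exponents (n + k) m = (\<lambda>(xs, ys). xs @ ys) ` (exponents n m \<times> exponents k m)"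
proof (intro equalityI subsetI)
  fix es assume es: "es \<in> exponents (n + k) m"
  then have "set (take n es) \<subseteq> {..m}" "set (drop n es) \<subseteq> {..m}"
    by (auto simp: exponents_def dest: in_set_takeD in_set_dropD)
  then have "(take n es, drop n es) \<in> exponents n m \<times> exponents k m"
    using es by (auto simp: exponents_def)
  then show "es \<in> (\<lambda>(xs, ys). xs @ ys) ` (exponents n m \<times> exponents k m)"
    by (intro image_eqI[of _ _ "(take n es, drop n es)"]) auto
qed (auto simp: exponents_def)

lemma inj_on_append_exponents:
  "inj_on (\<lambda>(xs, ys). xs @ ys) (exponents n m \<times> exponents k m)"
  by (auto simp: inj_on_def exponents_def)

lemma exponents_one: "exponents (Suc 0) m = (\<lambda>i. [i]) ` {..m}"
  by (auto simp: exponents_def length_Suc_conv)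

lemma monomials_mono: "m \<le> k \<Longrightarrow> monomials R us m \<subseteq> monomials R us k"
  unfolding monomials_def exponents_def by (intro image_mono) auto

lemma finite_monomials: "finite (monomials R us m)"
  and card_monomials_le: "card (monomials R us m) \<le> Suc m ^ length us"
  unfolding monomials_def
  by (simp add: finite_exponents)
     (metis card_image_le finite_exponents card_exponents)

context cring
begin

lemma monomial_mem_subring:
  assumes "subring U R" "set us \<subseteq> U"
  shows "monomial R us es \<in> U"
  using assms(2)
proof (induction us arbitrary: es)
  case (Cons u us)
  have "u [^] n \<in> U" for n :: nat
    by (induction n) (use Cons.prems subringE(3,6)[OF assms(1)] in auto)
  then show ?case using Cons subringE(6)[OF assms(1)] by auto
qed (use subringE(3)[OF assms(1)] in auto)

lemma monomial_closed: "set us \<subseteq> carrier R \<Longrightarrow> monomial R us es \<in> carrier R"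
  by (induction us arbitrary: es) auto

lemma monomials_closed: "set us \<subseteq> carrier R \<Longrightarrow> monomials R us m \<subseteq> carrier R"
  unfolding monomials_def using monomial_closed by auto

lemma monomial_append:
  assumes "set us \<subseteq> carrier R" "set vs \<subseteq> carrier R" "length xs = length us"
  shows "monomial R (us @ vs) (xs @ ys) = monomial R us xs \<otimes> monomial R vs ys"
  using assms(3,1)
  by (induction xs us rule: list_induct2)
     (use assms(2) in \<open>auto simp: monomial_closed m_assoc\<close>)

lemma monomial_zero_exponents: "set us \<subseteq> carrier R \<Longrightarrow> monomial R us (replicate (length us) 0) = \<one>"
  by (induction us) auto

lemma monomial_mult:
  assumes "set us \<subseteq> carrier R" "length es = length us" "length us = length fs"
  shows "monomial R us es \<otimes> monomial R us fs = monomial R us (map2 (+) es fs)"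
  using assms(2,3,1)
proof (induction es us fs rule: list_induct3)
  case (Cons e es u us f fs)
  then have IH: "monomial R us es \<otimes> monomial R us fs = monomial R us (map2 (+) es fs)"
    and c: "u \<in> carrier R" "monomial R us es \<in> carrier R" "monomial R us fs \<in> carrier R"
    by (auto simp: monomial_closed)
  have "u [^] e \<otimes> monomial R us es \<otimes> (u [^] f \<otimes> monomial R us fs) =
    (u [^] e \<otimes> u [^] f) \<otimes> (monomial R us es \<otimes> monomial R us fs)"
    using c by (simp add: m_ac)
  then show ?case using c IH by (simp add: nat_pow_mult)
qed auto

lemma monomials_mult:
  assumes "set us \<subseteq> carrier R" "g \<in> monomials R us m" "h \<in> monomials R us k"
  shows "g \<otimes> h \<in> monomials R us (m + k)"
proof -
  obtain es fs where *: "es \<in> exponents (length us) m" "fs \<in> exponents (length us) k"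
    "g = monomial R us es" "h = monomial R us fs"
    using assms unfolding monomials_def by auto
  then have "g \<otimes> h = monomial R us (map2 (+) es fs)"
    using monomial_mult[OF assms(1)] by (auto simp: exponents_def)
  moreover have "x + y \<le> m + k" if "(x, y) \<in> set (zip es fs)" for x y
    using set_zip_leftD[OF that] set_zip_rightD[OF that] *(1,2)
    by (intro add_mono) (auto simp: exponents_def)
  then have "map2 (+) es fs \<in> exponents (length us) (m + k)"
    using * by (auto simp: exponents_def)
  ultimately show ?thesis unfolding monomials_def by blast
qed

lemma one_in_monomials: "set us \<subseteq> carrier R \<Longrightarrow> \<one> \<in> monomials R us m"
  unfolding monomials_def
  by (rule image_eqI[of _ _ "replicate (length us) 0"])
     (auto simp: monomial_zero_exponents exponents_def)

lemma lin_span_mult: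
  assumes T: "subring T R" and "G \<subseteq> carrier R" "H \<subseteq> carrier R" "L \<subseteq> carrier R"
    and L: "\<And>g h. \<lbrakk>g \<in> G; h \<in> H\<rbrakk> \<Longrightarrow> g \<otimes> h \<in> L"
    and x: "x \<in> lin_span R T G" and y: "y \<in> lin_span R T H"
  shows "x \<otimes> y \<in> lin_span R T L"
  using x
proof induction
  case zero
  then show ?case
    using lin_span_closed[OF subringE(1)[OF T] assms(3) y] by (simp add: lin_span.zero)
next
  case (gen t g)
  have "g \<otimes> y \<in> lin_span R T L"
    using y
  proof induction
    case zero
    then show ?case using gen assms(2) by (auto simp: subset_iff intro: lin_span.zero)
  next
    case (gen s h)
    then have "g \<in> carrier R" "s \<in> carrier R" "h \<in> carrier R"
      using \<open>g \<in> G\<close> assms(2,3) subringE(1)[OF T] by auto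
    then have "g \<otimes> (s \<otimes> h) = s \<otimes> (g \<otimes> h)" by (simp add: m_lcomm)
    then show ?case using gen L \<open>g \<in> G\<close> by (auto intro: lin_span.gen)
  next
    case (add y y')
    then have "g \<in> carrier R" "y \<in> carrier R" "y' \<in> carrier R"
      using \<open>g \<in> G\<close> assms(2) lin_span_closed[OF subringE(1)[OF T] assms(3)] by auto
    then show ?case using add by (simp add: r_distr lin_span.add)
  qed
  moreover have "t \<otimes> g \<otimes> y = t \<otimes> (g \<otimes> y)"
    using gen assms(2) lin_span_closed[OF subringE(1)[OF T] assms(3) y] subringE(1)[OF T]
    by (intro m_assoc) auto
  ultimately show ?case using lin_span_smult[OF T assms(4)] gen by simp
next
  case (add x x')
  then have "x \<in> carrier R" "x' \<in> carrier R" "y \<in> carrier R"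
    using y lin_span_closed[OF subringE(1)[OF T]] assms(2,3) by auto
  then show ?case using add by (simp add: l_distr lin_span.add)
qed

lemma lin_span_monomials_mult:
  assumes "subring T R" "set us \<subseteq> carrier R"
    and "x \<in> lin_span R T (monomials R us m)" "y \<in> lin_span R T (monomials R us k)"
  shows "x \<otimes> y \<in> lin_span R T (monomials R us (m + k))"
  using lin_span_mult[OF assms(1) monomials_closed monomials_closed monomials_closed
      monomials_mult assms(3,4)] assms(2) by auto

lemma lin_span_monomials_mono:
  "m \<le> k \<Longrightarrow> lin_span R T (monomials R us m) \<subseteq> lin_span R T (monomials R us k)"
  by (intro lin_span_mono monomials_mono)

lemma subring_in_lin_span_monomials:
  assumes "subring T R" "set us \<subseteq> carrier R" "t \<in> T"
  shows "t \<in> lin_span R T (monomials R us m)"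
proof -
  have "t \<otimes> \<one> \<in> lin_span R T (monomials R us m)"
    using assms one_in_monomials by (intro lin_span.gen) auto
  then show ?thesis using assms subringE(1)[OF assms(1)] by (auto simp: subset_iff)
qed

lemma lin_span_monomials_pow:
  assumes "subring T R" "set us \<subseteq> carrier R" "x \<in> lin_span R T (monomials R us d)"
  shows "x [^] e \<in> lin_span R T (monomials R us (e * d))"
proof (induction e)
  case 0
  then show ?case
    using subring_in_lin_span_monomials[OF assms(1,2)] subringE(3)[OF assms(1)] by simp
next
  case (Suc e)
  then show ?case
    using lin_span_monomials_mult[OF assms(1,2) Suc assms(3)] by (simp add: add.commute)
qed

lemma monomial_in_lin_span_monomials:
  assumes "subring T R" "set us \<subseteq> carrier R"
    and "set vs \<subseteq> lin_span R T (monomials R us d)" "es \<in> exponents (length vs) m"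
  shows "monomial R vs es \<in> lin_span R T (monomials R us (length vs * (m * d)))"
  using assms(3,4)
proof (induction vs arbitrary: es)
  case Nil
  then show ?case
    using subring_in_lin_span_monomials[OF assms(1,2)] subringE(3)[OF assms(1)] by simp
next
  case (Cons v vs)
  then have es: "hd es \<le> m" "tl es \<in> exponents (length vs) m"
    by (cases es; auto simp: exponents_def)+
  have "v [^] hd es \<in> lin_span R T (monomials R us (hd es * d))"
    using lin_span_monomials_pow[OF assms(1,2)] Cons.prems by simp
  then have "v [^] hd es \<in> lin_span R T (monomials R us (m * d))"
    using lin_span_monomials_mono[of "hd es * d" "m * d"] es by auto
  then show ?case
    using lin_span_monomials_mult[OF assms(1,2)] Cons es by simp
qed

text \<open>
  The tower law for algebraic independence: a monomial in \<open>us @ vs\<close> is the product of a monomial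
  in \<open>us\<close>, which lies in \<open>U\<close>, and a monomial in \<open>vs\<close>.
\<close>

lemma algebraically_independent_append:
  assumes U: "subring U R" and TU: "T \<subseteq> U" and us: "set us \<subseteq> U" and vs: "set vs \<subseteq> carrier R"
    and "algebraically_independent R T us" "algebraically_independent R U vs"
  shows "algebraically_independent R T (us @ vs)"
  unfolding algebraically_independent_def
proof
  fix m
  let ?I = "exponents (length us) m" and ?J = "exponents (length vs) m"
  have usc: "set us \<subseteq> carrier R" and Tc: "T \<subseteq> carrier R"
    using us TU subringE(1)[OF U] by auto
  have "independent_family R T (?I \<times> ?J) (\<lambda>(i, j). monomial R us i \<otimes> monomial R vs j)"
    using assms(5,6) monomial_mem_subring[OF U us] monomial_closed[OF vs]
    by (intro independent_family_Times[OF U TU])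
       (auto simp: finite_exponents algebraically_independent_def)
  also have "?this \<longleftrightarrow>
    independent_family R T (?I \<times> ?J) (\<lambda>p. monomial R (us @ vs) (case p of (xs, ys) \<Rightarrow> xs @ ys))"
    unfolding independent_family_def
    using usc vs Tc monomial_append[OF usc vs]
    by (intro ball_cong arg_cong2[where f = "(\<longrightarrow>)"] arg_cong2[where f = "(=)"] refl finsum_cong')
       (auto simp: exponents_def monomial_closed Pi_def subset_iff)
  finally show "independent_family R T (exponents (length (us @ vs)) m) (monomial R (us @ vs))"
    unfolding length_append exponents_append using usc vs Tc
    by (intro independent_family_reindex inj_on_append_exponents)
       (auto simp: monomial_closed)
qed

lemma algebraically_independent_singleton:
  assumes "x \<in> carrier R" "T \<subseteq> carrier R"
    and "\<And>m. independent_family R T {..m} (\<lambda>i::nat. x [^] i)"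
  shows "algebraically_independent R T [x]"
  unfolding algebraically_independent_def
proof
  fix m
  have "independent_family R T {..m} (\<lambda>i. monomial R [x] [i])"
    using assms by simp
  then show "independent_family R T (exponents (length [x]) m) (monomial R [x])"
    using assms unfolding list.size add_0 exponents_one plus_nat.add_Suc
    by (intro independent_family_reindex) (auto simp: inj_on_def)
qed

lemma polynomial_ring_over_append:
  assumes T: "subring T R" and U: "subring U R" and TU: "T \<subseteq> U"
    and us: "set us \<subseteq> U" "algebraically_independent R T us"
      "U \<subseteq> (\<Union>m. lin_span R T (monomials R us m))"
    and vs: "polynomial_ring_over R U vs"
  shows "polynomial_ring_over R T (us @ vs)"
  unfolding polynomial_ring_over_def
proof (intro conjI)
  have usc: "set us \<subseteq> carrier R" using us subringE(1)[OF U] by auto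
  have vsc: "set vs \<subseteq> carrier R" using vs by (simp add: polynomial_ring_over_def)
  show c: "set (us @ vs) \<subseteq> carrier R" using usc vsc by simp
  show "algebraically_independent R T (us @ vs)"
    using vs by (intro algebraically_independent_append[OF U TU us(1) vsc us(2)])
      (simp add: polynomial_ring_over_def)
  let ?S = "\<lambda>m. lin_span R T (monomials R (us @ vs) m)"
  have us_sub: "monomials R us m \<subseteq> monomials R (us @ vs) m" for m
  proof
    fix g assume "g \<in> monomials R us m"
    then obtain xs where xs: "xs \<in> exponents (length us) m" "g = monomial R us xs"
      by (auto simp: monomials_def)
    then have "g = monomial R (us @ vs) (xs @ replicate (length vs) 0)"
      using usc vsc
      by (simp add: monomial_append monomial_zero_exponents monomial_closed exponents_def)
    then show "g \<in> monomials R (us @ vs) m"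
      using xs unfolding monomials_def
      by (intro image_eqI[of _ _ "xs @ replicate (length vs) 0"]) (auto simp: exponents_def)
  qed
  have vs_sub: "monomials R vs m \<subseteq> monomials R (us @ vs) m" for m
  proof
    fix g assume "g \<in> monomials R vs m"
    then obtain ys where ys: "ys \<in> exponents (length vs) m" "g = monomial R vs ys"
      by (auto simp: monomials_def)
    then have "g = monomial R (us @ vs) (replicate (length us) 0 @ ys)"
      using usc vsc
      by (simp add: monomial_append monomial_zero_exponents monomial_closed exponents_def)
    then show "g \<in> monomials R (us @ vs) m"
      using ys unfolding monomials_def
      by (intro image_eqI[of _ _ "replicate (length us) 0 @ ys"]) (auto simp: exponents_def)
  qed
  have "x \<in> (\<Union>m. ?S m)" if "x \<in> lin_span R U (monomials R vs k)" for x k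
    using that
  proof induction
    case zero
    show ?case by (auto intro: lin_span.zero)
  next
    case (gen u g)
    obtain m where "u \<in> lin_span R T (monomials R us m)" using gen us(3) by blast
    then have u: "u \<in> ?S m" using lin_span_mono[OF us_sub] by blast
    have "g \<in> carrier R" using monomials_closed[OF vsc] gen by auto
    then have "g \<in> ?S k"
      using lin_span.gen[OF subringE(3)[OF T], of g "monomials R (us @ vs) k" R] gen vs_sub
      by auto
    then show ?case using lin_span_monomials_mult[OF T c u] by blast
  next
    case (add x y)
    then obtain m n where "x \<in> ?S m" "y \<in> ?S n" by blast
    then have "x \<in> ?S (max m n)" "y \<in> ?S (max m n)"
      using lin_span_monomials_mono[of m "max m n" T "us @ vs"]
        lin_span_monomials_mono[of n "max m n" T "us @ vs"] by auto
    then show ?case using lin_span.add[of x R T _ y] by blast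
  qed
  then show "carrier R \<subseteq> (\<Union>m. ?S m)"
    using vs unfolding polynomial_ring_over_def by blast
qed

lemma polynomial_ring_over_Nil: "polynomial_ring_over R (carrier R) []"
proof -
  have "exponents 0 m = {[]}" for m by (auto simp: exponents_def)
  moreover have "x \<in> lin_span R (carrier R) {\<one>}" if "x \<in> carrier R" for x
    using lin_span.gen[of x "carrier R" \<one> "{\<one>}" R] that by auto
  ultimately show ?thesis
    by (auto simp: polynomial_ring_over_def algebraically_independent_def
        independent_family_def monomials_def)
qed

end

text \<open>
  The bound on the transcendence degree, proved by counting. If each of \<open>k\<close> elements is a combination
  of monomials in \<open>n\<close> generators with exponents at most \<open>d\<close>, then their \<open>Suc m ^ k\<close> monomials with exponents at most \<open>m\<close> lie in
  the span of \<open>Suc (k * m * d) ^ n\<close> monomials in the generators. When the former monomials are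
  linearly independent, comparing these numbers for large \<open>m\<close> gives \<open>k \<le> n\<close>.
\<close>

lemma (in domain) length_le_of_algebraically_independent:
  assumes T: "subring T R" and us: "set us \<subseteq> carrier R"
    and span: "carrier R \<subseteq> (\<Union>m. lin_span R T (monomials R us m))"
    and vs: "set vs \<subseteq> carrier R" "algebraically_independent R T vs"
  shows "length vs \<le> length us"
proof (rule ccontr)
  let ?n = "length us" and ?k = "length vs"
  assume "\<not> ?k \<le> ?n"
  then have kn: "Suc ?n \<le> ?k" by simp
  have "\<exists>d. set ws \<subseteq> lin_span R T (monomials R us d)" if "set ws \<subseteq> carrier R" for ws
    using that
  proof (induction ws)
    case (Cons w ws)
    then obtain d d' where "set ws \<subseteq> lin_span R T (monomials R us d)"
      "w \<in> lin_span R T (monomials R us d')" using span by fastforce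
    then have "set (w # ws) \<subseteq> lin_span R T (monomials R us (max d d'))"
      using lin_span_monomials_mono[of d "max d d'" T us]
        lin_span_monomials_mono[of d' "max d d'" T us] by (simp add: subset_iff)
    then show ?case by blast
  qed auto
  then obtain d where d: "set vs \<subseteq> lin_span R T (monomials R us d)" using vs by blast
  have bound: "Suc m ^ ?k \<le> Suc (?k * (m * d)) ^ ?n" for m
  proof -
    have "card (exponents ?k m) \<le> card (monomials R us (?k * (m * d)))"
      using vs(2) monomial_in_lin_span_monomials[OF T us d] monomials_closed[OF us]
      by (intro card_le_of_independent_lin_span[OF T, of _ _ "monomial R vs"])
         (auto simp: finite_exponents finite_monomials algebraically_independent_def)
    also have "\<dots> \<le> Suc (?k * (m * d)) ^ ?n" by (rule card_monomials_le)
    finally show ?thesis by (simp add: card_exponents)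
  qed
  \<comment> \<open>\<open>D\<close> absorbs all constants: \<open>Suc (k * m * d) \<le> D * Suc m\<close>, where \<open>D\<close> is independent of \<open>m\<close>.\<close>
  define D where "D = Suc (?k * d)"
  have "Suc m \<le> D ^ ?n" for m
  proof -
    have "Suc m ^ Suc ?n \<le> Suc m ^ ?k" using kn by (intro power_increasing) auto
    also have "\<dots> \<le> Suc (?k * (m * d)) ^ ?n" by (rule bound)
    also have "\<dots> \<le> (D * Suc m) ^ ?n" by (intro power_mono) (auto simp: D_def algebra_simps)
    also have "\<dots> = D ^ ?n * Suc m ^ ?n" by (rule power_mult_distrib)
    finally have "Suc m * Suc m ^ ?n \<le> D ^ ?n * Suc m ^ ?n" by simp
    then show ?thesis by (meson mult_le_cancel2 zero_less_Suc zero_less_power)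
  qed
  from this[of "D ^ ?n"] show False by simp
qed

section \<open>Factor-closed subrings\<close>

text \<open>
  Since all rings considered are commutative, the condition on the left factor covers both factors.
\<close>

definition factor_closed :: "('a, 'm) ring_scheme \<Rightarrow> 'a set \<Rightarrow> bool" where
  "factor_closed R T \<longleftrightarrow> (\<forall>x\<in>carrier R. \<forall>y\<in>carrier R.
     x \<otimes>\<^bsub>R\<^esub> y \<in> T \<longrightarrow> x \<otimes>\<^bsub>R\<^esub> y \<noteq> \<zero>\<^bsub>R\<^esub> \<longrightarrow> x \<in> T)"

text \<open>
  In a polynomial relation for \<open>a\<close> over \<open>T\<close>, the constant coefficient is a multiple of \<open>a\<close>. As \<open>a\<close>
  does not lie in the factor-closed subring \<open>T\<close>, this coefficient is zero, and \<open>a\<close> can be cancelled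
  from the remaining relation, which has smaller degree.
\<close>

lemma (in domain) algebraically_independent_of_not_mem_factor_closed:
  assumes T: "subring T R" and fc: "factor_closed R T" and a: "a \<in> carrier R" "a \<notin> T"
  shows "algebraically_independent R T [a]"
proof (rule algebraically_independent_singleton[OF a(1) subringE(1)[OF T]])
  have Tc: "T \<subseteq> carrier R" using subringE(1)[OF T] .
  have a0: "a \<noteq> \<zero>" using a subringE(2)[OF T] by auto
  have "\<forall>i\<in>{..m}. c i = \<zero>"
    if "c \<in> {..m} \<rightarrow> T" "(\<Oplus>i\<in>{..m}. c i \<otimes> a [^] (i::nat)) = \<zero>" for m c
    using that
  proof (induction m arbitrary: c)
    case 0
    then have "c 0 \<in> carrier R" using Tc by auto
    then show ?case using 0 by simp
  next
    case (Suc m)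
    have cT: "\<And>i. i \<le> Suc m \<Longrightarrow> c i \<in> T" using Suc.prems by auto
    then have cc: "\<And>i. i \<le> Suc m \<Longrightarrow> c i \<in> carrier R" using Tc by auto
    define s where "s = (\<Oplus>i\<in>{..m}. c (Suc i) \<otimes> a [^] i)"
    have sc: "s \<in> carrier R" unfolding s_def using cc a by (intro finsum_closed) auto
    have "(\<Oplus>i\<in>{..m}. c (Suc i) \<otimes> a [^] Suc i) = (\<Oplus>i\<in>{..m}. a \<otimes> (c (Suc i) \<otimes> a [^] i))"
      using cc a by (intro finsum_cong') (auto simp: m_ac)
    also have "\<dots> = a \<otimes> s"
      unfolding s_def using cc a by (subst finsum_rdistr) auto
    finally have eq: "a \<otimes> s \<oplus> c 0 = \<zero>"
      using Suc.prems cc a by (subst (asm) finsum_Suc2) auto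
    then have c0: "c 0 = a \<otimes> (\<ominus> s)"
      using a sc cc[of 0] by (metis minus_equality a_comm m_closed r_minus zero_le)
    have "a \<otimes> (\<ominus> s) \<in> T" using cT[of 0] c0 by simp
    then have "a \<otimes> (\<ominus> s) = \<zero>"
      using fc a a_inv_closed[OF sc] unfolding factor_closed_def by blast
    then have "c 0 = \<zero>" using c0 by simp
    then have "s = \<zero>" using eq a a0 sc by (simp add: integral_iff)
    have "(\<lambda>i. c (Suc i)) \<in> {..m} \<rightarrow> T" using cT by simp
    from Suc.IH[OF this \<open>s = \<zero>\<close>[unfolded s_def]]
    have "\<forall>i\<in>{..m}. c (Suc i) = \<zero>" .
    then show ?case using \<open>c 0 = \<zero>\<close> by (metis Suc_le_mono atMost_iff not0_implies_Suc)
  qed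
  then show "independent_family R T {..m} (\<lambda>i::nat. a [^] i)" for m
    unfolding independent_family_def by blast
qed

text \<open>
  An element \<open>a\<close> of \<open>U\<close> outside \<open>T\<close> would be transcendental over \<open>T\<close>. Together with the
  variables over \<open>U\<close> it would give more algebraically independent elements over \<open>T\<close> than
  there are variables over \<open>T\<close>.
\<close>

lemma (in domain) factor_closed_subring_eq_of_polynomial_rings:
  assumes T: "subring T R" "factor_closed R T" and U: "subring U R" and TU: "T \<subseteq> U"
    and us: "polynomial_ring_over R T us" and vs: "polynomial_ring_over R U vs"
    and len: "length us = length vs"
  shows "T = U"
proof (rule ccontr)
  assume "T \<noteq> U"
  then obtain a where a: "a \<in> U" "a \<notin> T" using TU by blast
  then have ac: "a \<in> carrier R" using subringE(1)[OF U] by auto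
  have "algebraically_independent R T ([a] @ vs)"
    using algebraically_independent_of_not_mem_factor_closed[OF T ac a(2)] vs a
    by (intro algebraically_independent_append[OF U TU]) (auto simp: polynomial_ring_over_def)
  then have "length ([a] @ vs) \<le> length us"
    using us vs ac
    by (intro length_le_of_algebraically_independent[OF T(1)]) (auto simp: polynomial_ring_over_def)
  then show False using len by simp
qed

section \<open>Transport along injective homomorphisms\<close>

lemma domain_of_inj_hom:
  assumes "cring R" "domain S" and h: "h \<in> ring_hom R S" "inj_on h (carrier R)"
  shows "domain R"
proof -
  interpret S: domain S by fact
  interpret ring_hom_cring R S h
    using assms by (simp add: ring_hom_cring_def ring_hom_cring_axioms_def S.is_cring)
  have zero_iff: "h x = \<zero>\<^bsub>S\<^esub> \<longleftrightarrow> x = \<zero>\<^bsub>R\<^esub>" if "x \<in> carrier R" for x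
    using h(2) that by (metis R.zero_closed hom_zero inj_on_def)
  show ?thesis
  proof (rule domain.intro[OF assms(1)], rule domain_axioms.intro)
    show "\<one>\<^bsub>R\<^esub> \<noteq> \<zero>\<^bsub>R\<^esub>" using zero_iff[of "\<one>\<^bsub>R\<^esub>"] by auto
    fix a b assume ab: "a \<otimes>\<^bsub>R\<^esub> b = \<zero>\<^bsub>R\<^esub>" "a \<in> carrier R" "b \<in> carrier R"
    then have "h a \<otimes>\<^bsub>S\<^esub> h b = \<zero>\<^bsub>S\<^esub>" by (metis hom_mult hom_zero)
    then show "a = \<zero>\<^bsub>R\<^esub> \<or> b = \<zero>\<^bsub>R\<^esub>"
      using ab zero_iff S.integral[of "h a" "h b"] by auto
  qed
qed

lemma cring_of_ring_iso:
  assumes "cring R" "h \<in> ring_iso R S" "h \<zero>\<^bsub>R\<^esub> = \<zero>\<^bsub>S\<^esub>"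
  shows "cring S"
  using cring.ring_iso_imp_img_cring[OF assms(1,2)] assms(3) by simp

lemma domain_of_ring_iso:
  assumes "domain R" "h \<in> ring_iso R S" "h \<zero>\<^bsub>R\<^esub> = \<zero>\<^bsub>S\<^esub>"
  shows "domain S"
  using domain.ring_iso_imp_img_domain[OF assms(1,2)] assms(3) by simp

lemma factor_closed_hom_image:
  assumes "cring R" "cring S" and h: "h \<in> ring_hom R S" "inj_on h (carrier R)"
    and R: "factor_closed S (h ` carrier R)" and T: "T \<subseteq> carrier R" "factor_closed R T"
  shows "factor_closed S (h ` T)"
  unfolding factor_closed_def
proof (intro ballI impI)
  interpret ring_hom_cring R S h
    using assms by (simp add: ring_hom_cring_def ring_hom_cring_axioms_def)
  fix x y assume xy: "x \<in> carrier S" "y \<in> carrier S"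
    "x \<otimes>\<^bsub>S\<^esub> y \<in> h ` T" "x \<otimes>\<^bsub>S\<^esub> y \<noteq> \<zero>\<^bsub>S\<^esub>"
  have "x \<otimes>\<^bsub>S\<^esub> y \<in> h ` carrier R" using xy T by auto
  moreover have "y \<otimes>\<^bsub>S\<^esub> x = x \<otimes>\<^bsub>S\<^esub> y" using xy by (simp add: S.m_comm)
  ultimately have "x \<in> h ` carrier R" "y \<in> h ` carrier R"
    using R xy unfolding factor_closed_def by metis+
  then obtain a b where ab: "a \<in> carrier R" "b \<in> carrier R" "x = h a" "y = h b" by auto
  obtain t where t: "t \<in> T" "x \<otimes>\<^bsub>S\<^esub> y = h t" using xy by auto
  then have "h (a \<otimes>\<^bsub>R\<^esub> b) = h t" using ab by simp
  then have "a \<otimes>\<^bsub>R\<^esub> b = t" using h(2) ab t T(1) by (auto simp: inj_on_def)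
  moreover have "a \<otimes>\<^bsub>R\<^esub> b \<noteq> \<zero>\<^bsub>R\<^esub>" using xy ab by (metis hom_mult hom_zero)
  ultimately have "a \<in> T" using T(2) t ab unfolding factor_closed_def by blast
  then show "x \<in> h ` T" using ab by simp
qed

lemma polynomial_ring_over_hom_image:
  assumes "cring R" "cring S" and h: "h \<in> ring_hom R S" "inj_on h (carrier R)"
    and T: "T \<subseteq> carrier R" and us: "polynomial_ring_over R T us"
  shows "set (map h us) \<subseteq> h ` carrier R"
    and "algebraically_independent S (h ` T) (map h us)"
    and "h ` carrier R \<subseteq> (\<Union>m. lin_span S (h ` T) (monomials S (map h us) m))"
proof -
  interpret ring_hom_cring R S h
    using assms by (simp add: ring_hom_cring_def ring_hom_cring_axioms_def)
  have usc: "set us \<subseteq> carrier R" using us by (simp add: polynomial_ring_over_def)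
  then show "set (map h us) \<subseteq> h ` carrier R" by auto
  have mon: "monomial S (map h us) es = h (monomial R us es)" for es
    using usc by (induction us arbitrary: es) (auto simp: R.monomial_closed)
  show "algebraically_independent S (h ` T) (map h us)"
    unfolding algebraically_independent_def
  proof
    fix m
    have "independent_family S (h ` T) (exponents (length us) m) (\<lambda>es. h (monomial R us es))"
      using us R.monomial_closed[OF usc]
      by (intro independent_family_hom_image[OF assms(1,2) h T])
         (auto simp: polynomial_ring_over_def algebraically_independent_def)
    then show "independent_family S (h ` T) (exponents (length (map h us)) m) (monomial S (map h us))"
      by (simp add: mon[abs_def])
  qed
  have "h x \<in> lin_span S (h ` T) (monomials S (map h us) m)"
    if "x \<in> lin_span R T (monomials R us m)" for x m
    using that
  proof induction
    case zero
    show ?case by (simp add: lin_span.zero)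
  next
    case (gen t g)
    then have "h g \<in> monomials S (map h us) m" by (auto simp: monomials_def mon)
    moreover have "t \<in> carrier R" using T gen by auto
    moreover have "g \<in> carrier R" using gen R.monomials_closed[OF usc] by auto
    ultimately show ?case using gen(1) lin_span.gen[of "h t" "h ` T" "h g"] by simp
  next
    case (add x y)
    then have "x \<in> carrier R" "y \<in> carrier R"
      using R.lin_span_closed[OF T R.monomials_closed[OF usc]] by blast+
    then show ?case using lin_span.add[OF add.IH] by simp
  qed
  then show "h ` carrier R \<subseteq> (\<Union>m. lin_span S (h ` T) (monomials S (map h us) m))"
    using us unfolding polynomial_ring_over_def by blast
qed

lemma polynomial_ring_over_ring_iso:
  assumes "cring R" "cring S" and h: "h \<in> ring_iso R S"
    and T: "T \<subseteq> carrier R" and us: "polynomial_ring_over R T us"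
  shows "polynomial_ring_over S (h ` T) (map h us)"
proof -
  have hh: "h \<in> ring_hom R S" "inj_on h (carrier R)" "h ` carrier R = carrier S"
    using h by (auto simp: ring_iso_def bij_betw_def)
  show ?thesis
    using polynomial_ring_over_hom_image[OF assms(1,2) hh(1,2) T us]
    unfolding polynomial_ring_over_def hh(3) by simp
qed

section \<open>The univariate polynomial ring\<close>

context UP_cring
begin

lemma polynomial_ring_over_UP:
  "polynomial_ring_over P ((\<lambda>a. monom P a 0) ` carrier R) [monom P \<one> 1]"
proof -
  let ?T = "(\<lambda>a. monom P a 0) ` carrier R" and ?X = "monom P \<one> 1"
  interpret P: cring P by (rule UP_cring)
  have X: "?X \<in> carrier P" by simp
  have pow: "?X [^]\<^bsub>P\<^esub> i = monom P \<one> i" for i :: nat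
    using monom_pow[of \<one> 1 i] by simp
  have mon: "monom P a 0 \<otimes>\<^bsub>P\<^esub> ?X [^]\<^bsub>P\<^esub> i = monom P a i" if "a \<in> carrier R" for a i
    using monom_mult[of a \<one> 0 i] that unfolding pow by simp
  have "independent_family P ?T {..m} (\<lambda>i::nat. ?X [^]\<^bsub>P\<^esub> i)" for m
    unfolding independent_family_def
  proof (intro ballI impI)
    fix c k assume c: "c \<in> {..m} \<rightarrow> ?T" and k: "k \<in> {..m}"
      and sum: "(\<Oplus>\<^bsub>P\<^esub>i\<in>{..m}. c i \<otimes>\<^bsub>P\<^esub> ?X [^]\<^bsub>P\<^esub> i) = \<zero>\<^bsub>P\<^esub>"
    have "\<forall>i\<in>{..m}. \<exists>a. a \<in> carrier R \<and> c i = monom P a 0" using c by auto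
    then obtain a where a: "\<And>i. i \<in> {..m} \<Longrightarrow> a i \<in> carrier R"
      "\<And>i. i \<in> {..m} \<Longrightarrow> c i = monom P (a i) 0" by metis
    have "(\<Oplus>\<^bsub>P\<^esub>i\<in>{..m}. c i \<otimes>\<^bsub>P\<^esub> ?X [^]\<^bsub>P\<^esub> i) = (\<Oplus>\<^bsub>P\<^esub>i\<in>{..m}. monom P (a i) i)"
      using a mon by (intro P.finsum_cong') auto
    then have "\<zero> = coeff P (\<Oplus>\<^bsub>P\<^esub>i\<in>{..m}. monom P (a i) i) k" using sum by simp
    also have "\<dots> = (\<Oplus>i\<in>{..m}. coeff P (monom P (a i) i) k)"
      using a by (intro coeff_finsum) auto
    also have "\<dots> = (\<Oplus>i\<in>{..m}. if k = i then a i else \<zero>)"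
      using a by (intro R.finsum_cong') (auto simp: eq_commute)
    also have "\<dots> = a k"
      using a k by (intro R.finsum_singleton) auto
    finally have "a k = \<zero>" by simp
    then show "c k = \<zero>\<^bsub>P\<^esub>" using a k by simp
  qed
  then have "algebraically_independent P ?T [?X]"
    by (intro P.algebraically_independent_singleton) auto
  moreover have "p \<in> (\<Union>m. lin_span P ?T (monomials P [?X] m))" if p: "p \<in> carrier P" for p
  proof -
    let ?S = "lin_span P ?T (monomials P [?X] (deg R p))"
    have Tc: "?T \<subseteq> carrier P" by auto
    have mc: "monomials P [?X] m \<subseteq> carrier P" for m
      by (rule P.monomials_closed) simp
    have "monom P (coeff P p i) i \<in> ?S" if "i \<le> deg R p" for i
    proof -
      have "monomial P [?X] [i] \<in> monomials P [?X] (deg R p)"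
        unfolding monomials_def using that by (intro imageI) (auto simp: exponents_def)
      then have "?X [^]\<^bsub>P\<^esub> i \<in> monomials P [?X] (deg R p)" by simp
      from lin_span.gen[OF _ this, of "monom P (coeff P p i) 0" ?T P] show ?thesis
        using mon[of "coeff P p i" i] p by simp
    qed
    then have "(\<Oplus>\<^bsub>P\<^esub>i\<in>{..deg R p}. monom P (coeff P p i) i) \<in> ?S"
      using P.lin_span_closed[OF Tc mc]
      by (intro P.finsum_mem) (auto intro: lin_span.zero lin_span.add)
    then show ?thesis using up_repr[OF p] by auto
  qed
  ultimately show ?thesis
    unfolding polynomial_ring_over_def using X by auto
qed

end

text \<open>
  Degrees add up in a polynomial ring over a domain, so the factors of a nonzero constant are
  constants.
\<close>

lemma (in UP_domain) factor_closed_UP: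
  "factor_closed P ((\<lambda>a. monom P a 0) ` carrier R)"
  unfolding factor_closed_def
proof (intro ballI impI)
  fix p q assume pq: "p \<in> carrier P" "q \<in> carrier P"
    "p \<otimes>\<^bsub>P\<^esub> q \<in> (\<lambda>a. monom P a 0) ` carrier R" "p \<otimes>\<^bsub>P\<^esub> q \<noteq> \<zero>\<^bsub>P\<^esub>"
  then have "p \<noteq> \<zero>\<^bsub>P\<^esub>" "q \<noteq> \<zero>\<^bsub>P\<^esub>" by auto
  then have "deg R (p \<otimes>\<^bsub>P\<^esub> q) = deg R p + deg R q" using pq by simp
  moreover have "deg R (p \<otimes>\<^bsub>P\<^esub> q) = 0" using pq(3) by auto
  ultimately have "deg R p = 0" by simp
  then have "p = monom P (coeff P p 0) 0" using deg_zero_impl_monom pq(1) by simp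
  then show "p \<in> (\<lambda>a. monom P a 0) ` carrier R"
    using pq(1) coeff_closed by blast
qed

section \<open>Poisson embeddings and the divisor subalgebra\<close>

definition poisson_embedding ::
    "('k, 'm) ring_scheme \<Rightarrow> ('k, 'a, 'n) poisson_scheme \<Rightarrow> ('k, 'b, 'p) poisson_scheme
      \<Rightarrow> ('a \<Rightarrow> 'b) \<Rightarrow> bool" where
  "poisson_embedding K A B h \<longleftrightarrow> h \<in> ring_hom A B \<and> inj_on h (carrier A)
     \<and> (\<forall>c\<in>carrier K. \<forall>x\<in>carrier A. h (c \<odot>\<^bsub>A\<^esub> x) = c \<odot>\<^bsub>B\<^esub> h x)
     \<and> (\<forall>x\<in>carrier A. \<forall>y\<in>carrier A. h \<lbrace>x, y\<rbrace>\<^bsub>A\<^esub> = \<lbrace>h x, h y\<rbrace>\<^bsub>B\<^esub>)"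

lemma poisson_algebra_cring: "poisson_algebra K A \<Longrightarrow> cring A"
  by (simp add: poisson_algebra_def algebra_def)

lemma poisson_algebra_smult_closed:
  "\<lbrakk>poisson_algebra K A; c \<in> carrier K; x \<in> carrier A\<rbrakk> \<Longrightarrow> c \<odot>\<^bsub>A\<^esub> x \<in> carrier A"
  by (meson algebra_def module.smult_closed poisson_algebra_def)

lemma poisson_embedding_of_iso: "h \<in> poisson_iso K A B \<Longrightarrow> poisson_embedding K A B h"
  by (auto simp: poisson_iso_def poisson_embedding_def ring_iso_def bij_betw_def)

lemma poisson_embedding_closed:
  "\<lbrakk>poisson_embedding K A B h; x \<in> carrier A\<rbrakk> \<Longrightarrow> h x \<in> carrier B"
  unfolding poisson_embedding_def by (meson ring_hom_closed)

lemma poisson_embedding_comp: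
  assumes f: "poisson_embedding K A B f" and g: "poisson_embedding K B C g"
  shows "poisson_embedding K A C (g \<circ> f)"
proof -
  have fh: "f \<in> ring_hom A B" "inj_on f (carrier A)" and gh: "g \<in> ring_hom B C" "inj_on g (carrier B)"
    using f g by (simp_all add: poisson_embedding_def)
  have "f ` carrier A \<subseteq> carrier B" using poisson_embedding_closed[OF f] by blast
  then have "inj_on (g \<circ> f) (carrier A)"
    by (rule comp_inj_on[OF fh(2) inj_on_subset[OF gh(2)]])
  moreover have "g \<circ> f \<in> ring_hom A C" by (rule ring_hom_trans[OF fh(1) gh(1)])
  ultimately show ?thesis
    using f g poisson_embedding_closed[OF f] by (simp add: poisson_embedding_def)
qed

lemma poisson_subalgebra_image:
  assumes A: "poisson_algebra K A" and B: "poisson_algebra K B" and f: "poisson_embedding K A B f"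
  shows "poisson_subalgebra K B (f ` carrier A)"
proof -
  have "f \<in> ring_hom A B" using f by (simp add: poisson_embedding_def)
  then interpret ring_hom_ring A B f
    using A B by (simp add: poisson_algebra_cring cring.axioms(1) ring_hom_ring_def
        ring_hom_ring_axioms_def)
  have sm: "c \<odot>\<^bsub>B\<^esub> f x = f (c \<odot>\<^bsub>A\<^esub> x)" if "c \<in> carrier K" "x \<in> carrier A" for c x
    using f that by (simp add: poisson_embedding_def)
  have br: "\<lbrace>f x, f y\<rbrace>\<^bsub>B\<^esub> = f \<lbrace>x, y\<rbrace>\<^bsub>A\<^esub>" if "x \<in> carrier A" "y \<in> carrier A" for x y
    using f that by (simp add: poisson_embedding_def)
  show ?thesis
    using img_is_subring[OF R.carrier_is_subring] poisson_algebra.bracket_closed[OF A]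
      poisson_algebra_smult_closed[OF A]
    by (auto simp: poisson_subalgebra_def sm br)
qed

lemma poisson_subalgebra_vimage:
  assumes A: "poisson_algebra K A" and B: "poisson_algebra K B" and f: "poisson_embedding K A B f"
    and T: "poisson_subalgebra K B T"
  shows "poisson_subalgebra K A {x \<in> carrier A. f x \<in> T}"
proof -
  have "f \<in> ring_hom A B" using f by (simp add: poisson_embedding_def)
  then interpret ring_hom_ring A B f
    using A B by (simp add: poisson_algebra_cring cring.axioms(1) ring_hom_ring_def
        ring_hom_ring_axioms_def)
  have T': "subring T B" using T by (simp add: poisson_subalgebra_def)
  have "subring {x \<in> carrier A. f x \<in> T} A"
    by (rule R.subringI) (use subringE[OF T'] in auto)
  then show ?thesis
    using T f poisson_algebra.bracket_closed[OF A] poisson_algebra_smult_closed[OF A]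
    by (auto simp: poisson_subalgebra_def poisson_embedding_def)
qed

text \<open>
  A factor-closed Poisson subalgebra is stable under both operations that build the divisor
  subalgebra: adjoining divisors and generating a Poisson subalgebra.
\<close>

lemma divisor_subalgebra_subset_factor_closed:
  assumes T: "poisson_subalgebra K A T" "factor_closed A T"
  shows "divisor_subalgebra K A {\<one>\<^bsub>A\<^esub>} \<subseteq> T"
proof -
  have "\<one>\<^bsub>A\<^esub> \<in> T" using T subringE(3) by (auto simp: poisson_subalgebra_def)
  have "divisor_step K A {\<one>\<^bsub>A\<^esub>} n \<subseteq> T" for n
  proof (induction n)
    case (Suc n)
    then have "Sw A (divisor_step K A {\<one>\<^bsub>A\<^esub>} n) \<subseteq> T"
      using T(2) unfolding Sw_def factor_closed_def by auto
    then show ?case using T(1) by (auto simp: poisson_generate_def)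
  qed (use \<open>\<one>\<^bsub>A\<^esub> \<in> T\<close> in auto)
  then show ?thesis by (auto simp: divisor_subalgebra_def)
qed

lemma poisson_isomorphic_of_image_eq:
  assumes f: "poisson_embedding K A S f" and g: "poisson_embedding K B S g"
    and A: "poisson_algebra K A" and B: "poisson_algebra K B"
    and eq: "f ` carrier A = g ` carrier B"
  shows "poisson_isomorphic K A B"
proof -
  interpret A: cring A using A by (rule poisson_algebra_cring)
  interpret B: cring B using B by (rule poisson_algebra_cring)
  define h where "h = (\<lambda>x. inv_into (carrier B) g (f x))"
  have h: "h x \<in> carrier B" "g (h x) = f x" if "x \<in> carrier A" for x
  proof -
    have "f x \<in> g ` carrier B" using eq that by auto
    then show "h x \<in> carrier B" "g (h x) = f x"
      unfolding h_def by (auto intro: inv_into_into f_inv_into_f)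
  qed
  have gi: "x = y" if "g x = g y" "x \<in> carrier B" "y \<in> carrier B" for x y
    using g that by (auto simp: poisson_embedding_def inj_on_def)
  have fi: "x = y" if "f x = f y" "x \<in> carrier A" "y \<in> carrier A" for x y
    using f that by (auto simp: poisson_embedding_def inj_on_def)
  have fh: "f \<in> ring_hom A S" and gh: "g \<in> ring_hom B S"
    using f g by (auto simp: poisson_embedding_def)
  note homs = ring_hom_mult[OF fh] ring_hom_mult[OF gh] ring_hom_add[OF fh] ring_hom_add[OF gh]
    ring_hom_one[OF fh] ring_hom_one[OF gh]
  have "bij_betw h (carrier A) (carrier B)"
  proof (rule bij_betwI')
    fix x y assume xy: "x \<in> carrier A" "y \<in> carrier A"
    then show "h x = h y \<longleftrightarrow> x = y" using h fi by metis
  next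
    fix y assume y: "y \<in> carrier B"
    then obtain x where x: "x \<in> carrier A" "g y = f x" using eq by (metis imageE imageI)
    then show "\<exists>x\<in>carrier A. y = h x" using h gi y by metis
  qed (use h in auto)
  then have "h \<in> ring_iso A B"
    by (intro ring_iso_memI) (auto simp: h homs intro!: gi)
  moreover have "h (c \<odot>\<^bsub>A\<^esub> x) = c \<odot>\<^bsub>B\<^esub> h x" if "c \<in> carrier K" "x \<in> carrier A" for c x
    using f g h that poisson_algebra_smult_closed[OF A] poisson_algebra_smult_closed[OF B]
    by (intro gi) (auto simp: poisson_embedding_def)
  moreover have "h \<lbrace>x, y\<rbrace>\<^bsub>A\<^esub> = \<lbrace>h x, h y\<rbrace>\<^bsub>B\<^esub>" if "x \<in> carrier A" "y \<in> carrier A" for x y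
    using f g h that poisson_algebra.bracket_closed[OF A] poisson_algebra.bracket_closed[OF B]
    by (intro gi) (auto simp: poisson_embedding_def)
  ultimately have "h \<in> poisson_iso K A B" by (simp add: poisson_iso_def)
  then show ?thesis by (auto simp: poisson_isomorphic_def)
qed

section \<open>Transport of structure\<close>

lemma image_poisson_ops:
  assumes "inj_on f (carrier A)"
  shows "carrier (image_poisson f A) = f ` carrier A"
    "\<one>\<^bsub>image_poisson f A\<^esub> = f \<one>\<^bsub>A\<^esub>" "\<zero>\<^bsub>image_poisson f A\<^esub> = f \<zero>\<^bsub>A\<^esub>"
    "\<lbrakk>x \<in> carrier A; y \<in> carrier A\<rbrakk> \<Longrightarrow> f x \<otimes>\<^bsub>image_poisson f A\<^esub> f y = f (x \<otimes>\<^bsub>A\<^esub> y)"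
    "\<lbrakk>x \<in> carrier A; y \<in> carrier A\<rbrakk> \<Longrightarrow> f x \<oplus>\<^bsub>image_poisson f A\<^esub> f y = f (x \<oplus>\<^bsub>A\<^esub> y)"
    "x \<in> carrier A \<Longrightarrow> c \<odot>\<^bsub>image_poisson f A\<^esub> f x = f (c \<odot>\<^bsub>A\<^esub> x)"
    "\<lbrakk>x \<in> carrier A; y \<in> carrier A\<rbrakk> \<Longrightarrow> \<lbrace>f x, f y\<rbrace>\<^bsub>image_poisson f A\<^esub> = f \<lbrace>x, y\<rbrace>\<^bsub>A\<^esub>"
  using assms by (simp_all add: image_poisson_def Let_def)

lemma
  assumes A: "poisson_algebra K A" and f: "inj_on f (carrier A)"
  shows poisson_iso_image_poisson: "f \<in> poisson_iso K A (image_poisson f A)"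
    and poisson_algebra_image_poisson: "poisson_algebra K (image_poisson f A)"
proof -
  let ?B = "image_poisson f A"
  interpret poisson_algebra K A by fact
  note ops = image_poisson_ops[OF f]
  have iso: "f \<in> ring_iso A ?B"
    using f by (intro ring_iso_memI) (auto simp: ops bij_betw_def)
  then show "f \<in> poisson_iso K A ?B" by (simp add: poisson_iso_def ops)
  have cring: "cring ?B"
    using cring_of_ring_iso[OF poisson_algebra_cring[OF A] iso] ops by simp
  have "algebra K ?B"
    by (rule algebraI[OF R.is_cring cring])
       (auto simp: ops smult_l_distr smult_r_distr smult_assoc1 smult_assoc2)
  moreover have "poisson_algebra_axioms K ?B"
    by (rule poisson_algebra_axioms.intro)
       (auto simp: ops bracket_closed bracket_add_left bracket_add_right bracket_smult_left
         bracket_smult_right bracket_self jacobi leibniz_left leibniz_right)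
  ultimately show "poisson_algebra K ?B"
    using ground.field_axioms by (intro poisson_algebra.intro)
qed

section \<open>Iterated Poisson-Ore extensions as polynomial rings\<close>

lemma poisson_ore_ext_structure:
  assumes C: "poisson_algebra K C" and D: "poisson_ore_ext K C \<alpha> \<delta> D"
  shows "poisson_algebra K D"
    and "poisson_embedding K C D (const_poly C)"
    and "polynomial_ring_over D (const_poly C ` carrier C) [poly_var C]"
    and "domain C \<Longrightarrow> domain D \<and> factor_closed D (const_poly C ` carrier C)"
proof -
  interpret C: cring C using C by (rule poisson_algebra_cring)
  interpret UP_cring C "UP C" by unfold_locales
  interpret P: cring "UP C" by (rule UP_cring)
  obtain br where br: "D = poly_poisson C br" using D by (auto simp: poisson_ore_ext_def)
  have ops: "carrier D = carrier (UP C)" "monoid.mult D = monoid.mult (UP C)"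
    "one D = one (UP C)" "zero D = zero (UP C)" "add D = add (UP C)"
    "smult D = (\<lambda>c p i. c \<odot>\<^bsub>C\<^esub> p i)"
    by (auto simp: br poly_poisson_def)
  show D': "poisson_algebra K D" using D by (simp add: poisson_ore_ext_def)
  have iso: "id \<in> ring_iso (UP C) D" by (intro ring_iso_memI) (auto simp: ops)
  have inj: "inj_on (const_poly C) (carrier C)" by (auto intro: inj_onI monom_inj)
  have hom: "const_poly C \<in> ring_hom C D"
    using const_ring_hom by (simp add: ring_hom_def ops)
  have sm: "const_poly C (c \<odot>\<^bsub>C\<^esub> x) = c \<odot>\<^bsub>D\<^esub> const_poly C x"
    if "c \<in> carrier K" "x \<in> carrier C" for c x
  proof -
    interpret pa: poisson_algebra K C by fact
    have "c \<odot>\<^bsub>C\<^esub> \<zero>\<^bsub>C\<^esub> = \<zero>\<^bsub>C\<^esub>" using that pa.smult_r_null by simp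
    then show ?thesis using that pa.smult_closed by (auto simp: ops UP_def)
  qed
  show "poisson_embedding K C D (const_poly C)"
    using inj hom sm D unfolding poisson_embedding_def poisson_ore_ext_def by simp
  show "polynomial_ring_over D (const_poly C ` carrier C) [poly_var C]"
    using polynomial_ring_over_ring_iso[OF UP_cring poisson_algebra_cring[OF D'] iso _
        polynomial_ring_over_UP] by (simp add: image_subset_iff)
  show "domain D \<and> factor_closed D (const_poly C ` carrier C)" if "domain C"
  proof
    interpret UP_domain C "UP C" using that by (simp add: UP_domain_def)
    show "domain D" using domain_of_ring_iso[OF UP_domain iso] by (simp add: ops)
    show "factor_closed D (const_poly C ` carrier C)"
      using factor_closed_UP unfolding factor_closed_def ops .
  qed
qed

text \<open>
  What the cancellation argument retains of an iterated Poisson-Ore extension: it is a polynomial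
  ring in \<open>n\<close> variables over an embedded copy of \<open>A\<close>, and this copy is factor-closed when \<open>A\<close>
  is a domain. These properties pass through each extension step.
\<close>

lemma iterated_poisson_ore_structure:
  fixes A :: "('k, 'a, 'n) poisson_scheme"
  assumes A: "poisson_algebra K A" and B: "iterated_poisson_ore K A n B"
  obtains h us where "poisson_algebra K B" "poisson_embedding K A B h" "length us = n"
    "polynomial_ring_over B (h ` carrier A) us"
    "domain A \<Longrightarrow> domain B" "domain A \<Longrightarrow> factor_closed B (h ` carrier A)"
proof -
  have "poisson_algebra K B \<and> (\<exists>h us. poisson_embedding K A B h \<and> length us = n \<and>
      polynomial_ring_over B (h ` carrier A) us \<and>
      (domain A \<longrightarrow> domain B \<and> factor_closed B (h ` carrier A)))"
    using B
  proof (induction n arbitrary: B)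
    case 0
    have inj: "inj_on Base (carrier A)" by (auto intro: inj_onI)
    have B: "B = image_poisson Base A" using 0 by simp
    have iso: "Base \<in> poisson_iso K A B" and pB: "poisson_algebra K B"
      using poisson_iso_image_poisson[OF A inj] poisson_algebra_image_poisson[OF A inj]
      by (simp_all add: B)
    have img: "Base ` carrier A = carrier B" by (simp add: B image_poisson_ops[OF inj])
    interpret B: cring B using pB by (rule poisson_algebra_cring)
    have "domain B" if "domain A"
      using domain_of_ring_iso[OF that, of Base B] iso
      by (simp add: poisson_iso_def B image_poisson_ops[OF inj])
    moreover have "factor_closed B (carrier B)" by (simp add: factor_closed_def)
    ultimately show ?case
      using pB poisson_embedding_of_iso[OF iso] B.polynomial_ring_over_Nil
      by (intro conjI exI[of _ Base] exI[of _ "[]"]) (simp_all add: img)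
  next
    case (Suc n)
    obtain C \<alpha> \<delta> D where C: "iterated_poisson_ore K A n C" and D: "poisson_ore_ext K C \<alpha> \<delta> D"
      and B: "B = image_poisson Coeffs D" using Suc.prems by auto
    from Suc.IH[OF C] obtain h us where pC: "poisson_algebra K C"
      and h: "poisson_embedding K A C h" and len: "length us = n"
      and us: "polynomial_ring_over C (h ` carrier A) us"
      and dom: "domain A \<Longrightarrow> domain C" "domain A \<Longrightarrow> factor_closed C (h ` carrier A)" by blast
    note step = poisson_ore_ext_structure[OF pC D]
    have inj: "inj_on Coeffs (carrier D)" by (auto intro: inj_onI)
    have iso: "Coeffs \<in> poisson_iso K D B" and pB: "poisson_algebra K B"
      using poisson_iso_image_poisson[OF step(1) inj] poisson_algebra_image_poisson[OF step(1) inj]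
      by (simp_all add: B)
    have riso: "Coeffs \<in> ring_iso D B" using iso by (simp add: poisson_iso_def)
    have img: "Coeffs ` carrier D = carrier B" by (simp add: B image_poisson_ops[OF inj])
    interpret B: cring B using pB by (rule poisson_algebra_cring)
    interpret D: cring D using step(1) by (rule poisson_algebra_cring)
    interpret C: cring C using pC by (rule poisson_algebra_cring)
    \<comment> \<open>One step adds a variable over the image of \<open>C\<close>, and the earlier variables come from \<open>C\<close>.\<close>
    define j where "j = Coeffs \<circ> const_poly C"
    have j: "poisson_embedding K C B j"
      unfolding j_def by (rule poisson_embedding_comp[OF step(2) poisson_embedding_of_iso[OF iso]])
    then have jh: "j \<in> ring_hom C B" "inj_on j (carrier C)" by (auto simp: poisson_embedding_def)
    have jimg: "j ` S = Coeffs ` const_poly C ` S" for S by (auto simp: j_def)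
    have hA: "h ` carrier A \<subseteq> carrier C" using poisson_embedding_closed[OF h] by auto
    have cC: "const_poly C ` carrier C \<subseteq> carrier D" using poisson_embedding_closed[OF step(2)] by auto
    have U: "subring (j ` carrier C) B"
      using poisson_subalgebra_image[OF pC pB j] by (simp add: poisson_subalgebra_def)
    have jh_emb: "poisson_embedding K A B (j \<circ> h)" by (rule poisson_embedding_comp[OF h j])
    have T: "subring (j ` h ` carrier A) B"
      using poisson_subalgebra_image[OF A pB jh_emb]
      by (simp add: poisson_subalgebra_def image_comp)
    have "polynomial_ring_over B (j ` carrier C) [Coeffs (poly_var C)]"
      using polynomial_ring_over_ring_iso[OF D.is_cring B.is_cring riso cC step(3)]
      by (simp add: jimg)
    then have "polynomial_ring_over B (j ` h ` carrier A) (map j us @ [Coeffs (poly_var C)])"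
      using polynomial_ring_over_hom_image[OF C.is_cring B.is_cring jh hA us] hA
      by (intro B.polynomial_ring_over_append[OF T U]) auto
    moreover have "domain B \<and> factor_closed B (j ` h ` carrier A)" if "domain A"
    proof
      have dD: "domain D" "factor_closed D (const_poly C ` carrier C)"
        using step(4) dom(1) that by auto
      show "domain B"
        using domain_of_ring_iso[OF dD(1) riso] by (simp add: B image_poisson_ops[OF inj])
      have "factor_closed B (Coeffs ` carrier D)" by (simp add: factor_closed_def img)
      moreover have "Coeffs \<in> ring_hom D B" using riso by (simp add: ring_iso_def)
      ultimately have "factor_closed B (j ` carrier C)"
        unfolding jimg by (intro factor_closed_hom_image[OF D.is_cring B.is_cring _ inj _ cC dD(2)])
      then show "factor_closed B (j ` h ` carrier A)"
        by (rule factor_closed_hom_image[OF C.is_cring B.is_cring jh _ hA dom(2)[OF that]])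
    qed
    ultimately show ?case
      using pB jh_emb len
      by (intro conjI exI[of _ "j \<circ> h"] exI[of _ "map j us @ [Coeffs (poly_var C)]"])
         (simp_all only: image_comp length_append length_map list.size, auto)
  qed
  then show ?thesis using that by blast
qed

section \<open>Strong skew cancellativity\<close>

theorem theorem4p8:
  fixes K :: "('k, 'm) ring_scheme"
    and A :: "('k, 'a, 'n) poisson_scheme"
  assumes "field K" and "char_zero K"
    and "poisson_algebra K A" and "domain A"
    and "noetherian_ring A"
    and "krull_dim A < \<infinity>"
    and "divisor_subalgebra K A {\<one>\<^bsub>A\<^esub>} = carrier A"
  shows "strongly_poisson_skew_cancellative TYPE('b) K A"
  unfolding strongly_poisson_skew_cancellative_def
proof (intro allI impI)
  fix n :: nat and A' :: "('k, 'b) poisson" and B B'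
  assume A': "poisson_algebra K A'"
    and ext: "iterated_poisson_ore K A n B" and ext': "iterated_poisson_ore K A' n B'"
    and BB': "poisson_isomorphic K B B'"
  note A = assms(3)
  obtain i us where B: "poisson_algebra K B" and i: "poisson_embedding K A B i"
    and us: "length us = n" "polynomial_ring_over B (i ` carrier A) us"
    and dB: "domain B" and fB: "factor_closed B (i ` carrier A)"
    using iterated_poisson_ore_structure[OF A ext] assms(4) by metis
  obtain i' us' where B': "poisson_algebra K B'" and i': "poisson_embedding K A' B' i'"
    and us': "length us' = n" "polynomial_ring_over B' (i' ` carrier A') us'"
    and fB': "domain A' \<Longrightarrow> factor_closed B' (i' ` carrier A')"
    using iterated_poisson_ore_structure[OF A' ext'] by metis
  obtain h where h: "h \<in> poisson_iso K B B'"
    using BB' by (auto simp: poisson_isomorphic_def)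
  then have hr: "h \<in> ring_iso B B'" by (simp add: poisson_iso_def)
  then have hh: "h \<in> ring_hom B B'" "inj_on h (carrier B)" "h ` carrier B = carrier B'"
    by (auto simp: ring_iso_def bij_betw_def)
  interpret B: domain B by fact
  interpret B': cring B' using B' by (rule poisson_algebra_cring)
  interpret h: ring_hom_cring B B' h
    using hh by (simp add: ring_hom_cring_def ring_hom_cring_axioms_def B.is_cring B'.is_cring)
  interpret B': domain B' by (rule domain_of_ring_iso[OF dB hr h.hom_zero])
  have i'h: "i' \<in> ring_hom A' B'" "inj_on i' (carrier A')"
    using i' by (auto simp: poisson_embedding_def)
  have dA': "domain A'"
    by (rule domain_of_inj_hom[OF poisson_algebra_cring[OF A'] B'.domain_axioms i'h])
  define f where "f = h \<circ> i"
  have f: "poisson_embedding K A B' f"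
    unfolding f_def by (rule poisson_embedding_comp[OF i poisson_embedding_of_iso[OF h]])
  have fimg: "f ` carrier A = h ` i ` carrier A" by (simp add: f_def image_comp)
  have iA: "i ` carrier A \<subseteq> carrier B" using poisson_embedding_closed[OF i] by auto
  let ?U = "i' ` carrier A'"
  have U: "poisson_subalgebra K B' ?U" by (rule poisson_subalgebra_image[OF A' B' i'])
  have T: "poisson_subalgebra K B' (f ` carrier A)" by (rule poisson_subalgebra_image[OF A B' f])
  have "factor_closed A {x \<in> carrier A. f x \<in> ?U}"
    unfolding factor_closed_def
  proof (intro ballI impI)
    fix x y assume xy: "x \<in> carrier A" "y \<in> carrier A"
      "x \<otimes>\<^bsub>A\<^esub> y \<in> {x \<in> carrier A. f x \<in> ?U}" "x \<otimes>\<^bsub>A\<^esub> y \<noteq> \<zero>\<^bsub>A\<^esub>"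
    interpret A: cring A using A by (rule poisson_algebra_cring)
    interpret f: ring_hom_cring A B' f
      using f by (simp add: ring_hom_cring_def ring_hom_cring_axioms_def A.is_cring B'.is_cring
          poisson_embedding_def)
    have inj: "inj_on f (carrier A)" using f by (simp add: poisson_embedding_def)
    have "f (x \<otimes>\<^bsub>A\<^esub> y) \<noteq> f \<zero>\<^bsub>A\<^esub>"
      using xy(4) inj_onD[OF inj _ A.m_closed[OF xy(1,2)] A.zero_closed] by blast
    then have "f (x \<otimes>\<^bsub>A\<^esub> y) \<noteq> \<zero>\<^bsub>B'\<^esub>" by simp
    then show "x \<in> {x \<in> carrier A. f x \<in> ?U}"
      using xy fB'[OF dA'] unfolding factor_closed_def by auto
  qed
  \<comment> \<open>The preimage of \<open>A'\<close> under \<open>f\<close> contains the divisor subalgebra of 1, which is all of \<open>A\<close>.\<close>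
  from divisor_subalgebra_subset_factor_closed[OF poisson_subalgebra_vimage[OF A B' f U] this]
  have sub: "f ` carrier A \<subseteq> ?U" using assms(7) by auto
  have fcl: "factor_closed B' (f ` carrier A)"
    unfolding fimg
    by (rule factor_closed_hom_image[OF B.is_cring B'.is_cring hh(1,2) _ iA fB])
       (simp add: hh(3) factor_closed_def)
  have "polynomial_ring_over B' (f ` carrier A) (map h us)"
    unfolding fimg by (rule polynomial_ring_over_ring_iso[OF B.is_cring B'.is_cring hr iA us(2)])
  moreover have "subring (f ` carrier A) B'" "subring ?U B'"
    using T U by (simp_all add: poisson_subalgebra_def)
  moreover have "length (map h us) = length us'" using us(1) us'(1) by simp
  ultimately have "f ` carrier A = ?U"
    using B'.factor_closed_subring_eq_of_polynomial_rings[OF _ fcl _ sub _ us'(2)] by blast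
  then show "poisson_isomorphic K A A'"
    by (rule poisson_isomorphic_of_image_eq[OF f i' A A'])
qed

end
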